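(* Let $\delta>0$ and $\gamma\ge 0$, let $G$ be the inverse Gaussian subordinator with parameters $(\delta,\gamma)$, let $H(t)=\inf\{u>0: G(u)>t\}$, and let $h(x,t)$ be the density function of $H(t)$. Then the Laplace transform of $h(x,t)$ with respect to $t$ is given by $$\int_0^\infty e^{-st}h(x,t)\,dt = \frac{\delta}{s}\left(\sqrt{\gamma^2+2s}-\gamma\right) e^{-\delta x(\sqrt{\gamma^2+2s}-\gamma)},\qquad x>0,\ s>0.$$
   Context: Let $B$ be a standard Brownian motion. The inverse Gaussian (IG) subordinator with parameters $(\delta,\gamma)$ is $G(t)=\inf\{s>0: B(s)+\gamma s>\delta t\}$; it is a strictly increasing L\'evy process started at $0$ with $\mathbb{E}\,e^{-sG(x)}=e^{-\delta x(\sqrt{\gamma^2+2s}-\gamma)}$ for $s\ge 0$. Its first-exit time process is $H(t)=\inf\{u>0: G(u)>t\}$, $t\ge 0$, and $h(x,t)$ denotes the density in $x$ of $H(t)$. *)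

theory Defs
  imports "HOL-Probability.Probability"
begin

text \<open>Processes are indexed by \<^typ>\<open>real\<close>; only the values at nonnegative times matter. Paths
  are required to start at 0 and to be continuous only almost surely.\<close>

locale standard_brownian_motion = prob_space M
  for M :: "'a measure" +
  fixes B :: "real \<Rightarrow> 'a \<Rightarrow> real"
  assumes measurable: "0 \<le> t \<Longrightarrow> B t \<in> borel_measurable M"
    and start_zero: "AE \<omega> in M. B 0 \<omega> = 0"
    and indep_increments:
      "0 \<le> \<tau> 0 \<Longrightarrow> (\<And>i. i < n \<Longrightarrow> \<tau> i < \<tau> (Suc i)) \<Longrightarrow>
        indep_vars (\<lambda>_. borel) (\<lambda>i \<omega>. B (\<tau> (Suc i)) \<omega> - B (\<tau> i) \<omega>) {..<n::nat}"
    and normal_increments: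
      "0 \<le> r \<Longrightarrow> r < t \<Longrightarrow>
        distributed M lborel (\<lambda>\<omega>. B t \<omega> - B r \<omega>) (normal_density 0 (sqrt (t - r)))"
    and continuous_paths: "AE \<omega> in M. continuous_on {0..} (\<lambda>t. B t \<omega>)"

text \<open>The infima below are taken in \<^typ>\<open>real\<close>. For a Brownian motion \<open>B\<close> and
  \<open>\<delta> > 0\<close>, \<open>\<gamma> \<ge> 0\<close> the sets involved are almost surely nonempty, so the unspecified
  value of \<open>Inf {}\<close> plays no role.\<close>

definition ig_subordinator ::
    "(real \<Rightarrow> 'a \<Rightarrow> real) \<Rightarrow> real \<Rightarrow> real \<Rightarrow> real \<Rightarrow> 'a \<Rightarrow> real" where
  "ig_subordinator B \<delta> \<gamma> t \<omega> = Inf {s. 0 < s \<and> B s \<omega> + \<gamma> * s > \<delta> * t}"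

definition first_exit_time :: "(real \<Rightarrow> 'a \<Rightarrow> real) \<Rightarrow> real \<Rightarrow> 'a \<Rightarrow> real" where
  "first_exit_time G t \<omega> = Inf {u. 0 < u \<and> G u \<omega> > t}"

text \<open>A density is determined only almost everywhere, so a pointwise statement about it needs a
  fixed version: \<open>h x t\<close> is the version that is continuous in \<open>x\<close> on the open half-line. Time
  0 is excluded because a first-exit time at level 0 is almost surely 0.\<close>

definition density_family ::
    "'a measure \<Rightarrow> (real \<Rightarrow> 'a \<Rightarrow> real) \<Rightarrow> (real \<Rightarrow> real \<Rightarrow> real) \<Rightarrow> bool" where
  "density_family M H h \<longleftrightarrow>
    (\<forall>t>0. (\<forall>x. 0 \<le> h x t) \<and> distributed M lborel (H t) (\<lambda>x. ennreal (h x t)) \<and>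
      continuous_on {0<..} (\<lambda>x. h x t))"

end

theory Submission
  imports Defs "HOL-Real_Asymp.Real_Asymp"
begin

text \<open>Write \<open>X s = B s + \<gamma> * s\<close>. On a continuous path, \<open>G u > t\<close> says, up to the boundary
  value of \<open>u\<close>, that \<open>X\<close> has not risen above \<open>\<delta> * u\<close> by time \<open>t\<close>. Hence \<open>H t\<close> is the maximum of
  \<open>X\<close> over \<open>[0, t]\<close> divided by \<open>\<delta>\<close> (\<open>first_exit_time_le_iff\<close>), and everything depends on the law of
  this maximum. With \<open>\<Phi>\<close> the standard normal distribution function, that law is
  \<open>u t y = \<Phi> ((y - \<gamma> t) / \<surd>t) - e^(2 \<gamma> y) * \<Phi> (- (y + \<gamma> t) / \<surd>t)\<close>.

  The formula for \<open>u\<close> comes from the method of images. Put \<open>w y = 1\<close> for \<open>y \<ge> 0\<close> and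
  \<open>w y = - e^(2 \<gamma> y)\<close> for \<open>y < 0\<close>; then \<open>u t y = E (w (y - X t))\<close>. Thus \<open>u\<close> is a semigroup orbit
  (\<open>barrier_prob_semigroup\<close>), bounded by 1, and \<open>w\<close> is tuned so that \<open>u t y\<close> has the sign of \<open>y\<close>
  (\<open>barrier_prob_nonneg\<close>, \<open>barrier_prob_nonpos\<close>). Let \<open>v n y\<close> be the probability that \<open>X\<close> observed at
  \<open>n\<close> equidistant times stays below \<open>y\<close>. It satisfies the recursion of \<open>u\<close> except that it is set to 0
  below the level, so the signs of \<open>u\<close> give \<open>u t y \<le> v n y\<close> by induction; raising the level by
  \<open>\<epsilon>\<close> gives \<open>v n y \<le> u t (y + \<epsilon>)\<close> up to \<open>n\<close> times the probability that one step exceeds \<open>\<epsilon>\<close>, which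
  vanishes as the grid is refined. Below, \<open>u\<close> is \<open>barrier_prob\<close> and \<open>v\<close> is \<open>survival\<close>;
  \<open>prob_path_below\<close> is the resulting law.

  The version \<open>h\<close> that is continuous in \<open>x\<close> is therefore \<open>\<delta>\<close> times the derivative of \<open>u t\<close> at
  \<open>\<delta> * x\<close>, for every \<open>x > 0\<close> and \<open>t > 0\<close> and not merely almost everywhere. For this explicit function
  \<open>e^(- s t) * h x t\<close> has an antiderivative in \<open>t\<close> built from \<open>\<Phi>\<close> and exponentials
  (\<open>laplace_running_max_density\<close>). The integrand is nonnegative, so the difference of the limits
  of this antiderivative at \<open>\<infinity>\<close> and at 0 is the Laplace transform.\<close>

section \<open>The Gaussian distribution function\<close>

definition Phi :: "real \<Rightarrow> real" where "Phi = cdf std_normal_distribution"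

interpretation std_normal: real_distribution std_normal_distribution
  by (rule real_dist_normal_dist)

lemma Phi_has_real_derivative: "(Phi has_real_derivative std_normal_density x) (at x)"
proof -
  have cont: "continuous_on A std_normal_density" for A
    unfolding std_normal_density_def by (intro continuous_intros) auto
  define F where "F y = Phi (x - 1) + integral {x - 1..y} std_normal_density" for y
  have eq: "Phi y = F y" if "y > x - 1" for y
  proof -
    have "Phi y - Phi (x - 1) = measure std_normal_distribution {x - 1<..y}"
      using std_normal.cdf_diff_eq[OF that] by (simp add: Phi_def)
    also have "\<dots> = integral\<^sup>L std_normal_distribution (indicator {x - 1<..y})"
      by simp
    also have "\<dots> = (LINT z|lborel. std_normal_density z * indicator {x - 1<..y} z)"
      by (subst integral_density) auto
    also have "\<dots> = (LINT z:{x - 1..y}|lborel. std_normal_density z)"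
      unfolding set_lebesgue_integral_def
      by (intro integral_cong_AE, simp, simp) (use AE_lborel_singleton[of "x - 1"] in \<open>auto split: split_indicator\<close>)
    also have "\<dots> = integral {x - 1..y} std_normal_density"
      by (rule set_borel_integral_eq_integral)
         (intro borel_integrable_atLeastAtMost' cont)
    finally show ?thesis by (simp add: F_def)
  qed
  have "((\<lambda>y. integral {x - 1..y} std_normal_density) has_real_derivative std_normal_density x)
      (at x within {x - 1..x + 1})"
    by (rule integral_has_real_derivative[OF cont]) auto
  then have "((\<lambda>y. integral {x - 1..y} std_normal_density) has_real_derivative std_normal_density x) (at x)"
    by (subst (asm) at_within_Icc_at) auto
  then have "(F has_real_derivative std_normal_density x) (at x)"
    unfolding F_def by (auto intro!: derivative_eq_intros)
  then show ?thesis
    by (rule DERIV_cong_ev[THEN iffD1, rotated -1])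
       (use eq in \<open>auto intro!: eventually_mono[OF eventually_nhds_in_open[of "{x - 1<..}"]]\<close>)
qed

text \<open>The one-dimensional Cameron--Martin formula: completing the square turns an exponential weight
  into a translation. It evaluates the image term of the barrier probability and yields the
  inequality \<open>exp_Phi_le\<close>.\<close>

lemma integral_std_normal_tilt:
  assumes [measurable]: "f \<in> borel_measurable borel"
  shows "(\<integral>z. exp (m * z) * f z \<partial>std_normal_distribution) =
    exp (m\<^sup>2 / 2) * (\<integral>z. f (z + m) \<partial>std_normal_distribution)"
proof -
  have "(\<integral>z. exp (m * z) * f z \<partial>std_normal_distribution) =
      (\<integral>z. std_normal_density z * (exp (m * z) * f z) \<partial>lborel)"
    by (subst integral_density) auto
  also have "\<dots> = (\<integral>z. std_normal_density (m + z) * (exp (m * (m + z)) * f (m + z)) \<partial>lborel)"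
    by (subst lborel_integral_real_affine[where c = 1 and t = m]) auto
  also have "\<dots> = (\<integral>z. exp (m\<^sup>2 / 2) * (std_normal_density z * f (z + m)) \<partial>lborel)"
  proof (intro Bochner_Integration.integral_cong refl)
    fix z
    have "std_normal_density (m + z) * exp (m * (m + z)) = exp (m\<^sup>2 / 2) * std_normal_density z"
      unfolding std_normal_density_def
      by (simp add: exp_add[symmetric] field_simps power2_eq_square)
    then show "std_normal_density (m + z) * (exp (m * (m + z)) * f (m + z)) =
        exp (m\<^sup>2 / 2) * (std_normal_density z * f (z + m))"
      by (metis add.commute mult.assoc)
  qed
  also have "\<dots> = exp (m\<^sup>2 / 2) * (\<integral>z. f (z + m) \<partial>std_normal_distribution)"
    by (subst integral_density) auto
  finally show ?thesis .
qed

lemma distr_std_normal_scale: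
  assumes "0 < \<sigma>"
  shows "distr std_normal_distribution borel (\<lambda>z. \<mu> + \<sigma> * z) = density lborel (normal_density \<mu> \<sigma>)"
proof -
  have "distributed std_normal_distribution lborel (\<lambda>z. z) std_normal_density"
    by (auto simp: distributed_def distr_id2)
  from std_normal.normal_density_affine[OF this, of \<sigma> \<mu>] assms
  have "distributed std_normal_distribution lborel (\<lambda>z. \<mu> + \<sigma> * z) (normal_density \<mu> \<sigma>)"
    by simp
  from distributed_distr_eq_density[OF this]
  have "distr std_normal_distribution lborel (\<lambda>z. \<mu> + \<sigma> * z) = density lborel (normal_density \<mu> \<sigma>)" .
  moreover have "distr std_normal_distribution borel (\<lambda>z. \<mu> + \<sigma> * z) =
      distr std_normal_distribution lborel (\<lambda>z. \<mu> + \<sigma> * z)"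
    by (rule distr_cong) auto
  ultimately show ?thesis by simp
qed

text \<open>Degenerate variances \<open>\<sigma> = 0\<close> or \<open>\<tau> = 0\<close> are included, so that the semigroup property below
  also covers time 0.\<close>

lemma integral_std_normal_add:
  fixes f :: "real \<Rightarrow> real"
  assumes [measurable]: "f \<in> borel_measurable borel" and bnd: "\<And>x. \<bar>f x\<bar> \<le> C"
    and "0 \<le> \<sigma>" "0 \<le> \<tau>"
  shows "(\<integral>x. (\<integral>y. f (\<sigma> * x + \<tau> * y) \<partial>std_normal_distribution) \<partial>std_normal_distribution) =
    (\<integral>z. f (sqrt (\<sigma>\<^sup>2 + \<tau>\<^sup>2) * z) \<partial>std_normal_distribution)"
proof (cases "\<sigma> = 0 \<or> \<tau> = 0")
  case True
  then show ?thesis using assms(3,4) std_normal.prob_space by auto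
next
  case False
  let ?N = "\<lambda>s. density lborel (normal_density 0 s)"
  have pos: "\<sigma> > 0" "\<tau> > 0" using False assms(3,4) by auto
  have pos': "sqrt (\<sigma>\<^sup>2 + \<tau>\<^sup>2) > 0" using pos by (simp add: add_pos_pos)
  interpret S: prob_space "?N \<sigma>" by (rule prob_space_normal_density) (use pos in auto)
  interpret T: prob_space "?N \<tau>" by (rule prob_space_normal_density) (use pos in auto)
  interpret ST: pair_prob_space "?N \<sigma>" "?N \<tau>" ..
  have scale: "(\<integral>z. g z \<partial>?N s) = (\<integral>z. g (s * z) \<partial>std_normal_distribution)"
    if "s > 0" and [measurable]: "g \<in> borel_measurable borel" for s and g :: "real \<Rightarrow> real"
    using distr_std_normal_scale[OF that(1), of 0, symmetric] by (simp add: integral_distr)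
  have "(\<integral>z. f (sqrt (\<sigma>\<^sup>2 + \<tau>\<^sup>2) * z) \<partial>std_normal_distribution) = (\<integral>z. f z \<partial>?N (sqrt (\<sigma>\<^sup>2 + \<tau>\<^sup>2)))"
    by (rule scale[symmetric]) (use pos' in auto)
  also have "?N (sqrt (\<sigma>\<^sup>2 + \<tau>\<^sup>2)) = (?N \<sigma> \<star> ?N \<tau>)"
    by (subst convolution_density)
       (auto simp: conv_normal_density_zero_mean[OF pos, symmetric] ennreal_mult'
         intro: S.finite_measure T.finite_measure S.finite_measure_axioms T.finite_measure_axioms)
  also have "(\<integral>z. f z \<partial>(?N \<sigma> \<star> ?N \<tau>)) = (\<integral>p. f (fst p + snd p) \<partial>(?N \<sigma> \<Otimes>\<^sub>M ?N \<tau>))"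
    unfolding convolution_def by (subst integral_distr) (auto simp: case_prod_beta)
  also have "\<dots> = (\<integral>x. (\<integral>y. f (x + y) \<partial>?N \<tau>) \<partial>?N \<sigma>)"
    by (subst ST.integral_fst'[symmetric]) (auto intro!: ST.P.integrable_const_bound[where B = C] bnd)
  also have "\<dots> = (\<integral>x. (\<integral>y. f (\<sigma> * x + y) \<partial>?N \<tau>) \<partial>std_normal_distribution)"
    by (rule scale) (use pos in auto)
  also have "\<dots> = (\<integral>x. (\<integral>y. f (\<sigma> * x + \<tau> * y) \<partial>std_normal_distribution) \<partial>std_normal_distribution)"
    by (intro Bochner_Integration.integral_cong refl scale) (use pos in auto)
  finally show ?thesis by simp
qed

lemma Phi_at_top: "(Phi \<longlongrightarrow> 1) at_top"
  unfolding Phi_def by (rule std_normal.cdf_lim_at_top_prob)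

lemma Phi_at_bot: "(Phi \<longlongrightarrow> 0) at_bot"
  unfolding Phi_def by (rule std_normal.cdf_lim_at_bot)

lemma Phi_nonneg: "0 \<le> Phi x"
  unfolding Phi_def by (rule std_normal.cdf_nonneg)

lemma Phi_eq_integral: "Phi c = (\<integral>z. indicator {..c} z \<partial>std_normal_distribution)"
  by (simp add: Phi_def cdf_def)

text \<open>The sum \<open>Phi (- x) + Phi x\<close> has derivative 0 because the density is even, and it tends to 1
  at infinity.\<close>

lemma Phi_minus: "Phi (- x) = 1 - Phi x"
proof -
  have d: "((\<lambda>x. Phi (- x) + Phi x) has_real_derivative 0) (at x)" for x
  proof -
    have "((\<lambda>x. Phi (- x)) has_real_derivative std_normal_density (- x) * - 1) (at x)"
      by (rule DERIV_chain2[OF Phi_has_real_derivative]) (auto intro!: derivative_eq_intros)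
    from DERIV_add[OF this Phi_has_real_derivative] show ?thesis
      by (simp add: std_normal_density_def)
  qed
  have c: "Phi (- x) + Phi x = Phi (- 0) + Phi 0" for x
    by (rule DERIV_isconst_all) (use d in blast)
  have "((\<lambda>x. Phi (- x) + Phi x) \<longlongrightarrow> 0 + 1) at_top"
    by (intro tendsto_add filterlim_compose[OF Phi_at_bot]
        Phi_at_top filterlim_uminus_at_bot_at_top)
  moreover have "(\<lambda>x. Phi (- x) + Phi x) = (\<lambda>x. Phi (- 0) + Phi 0)"
    by (rule ext) (rule c)
  ultimately have "Phi (- 0) + Phi 0 = 0 + 1"
    by (metis tendsto_unique[OF trivial_limit_at_top_linorder tendsto_const])
  with c[of x] show ?thesis by linarith
qed

section \<open>The probability of staying below a level\<close>

text \<open>Reflection at a level turns drift \<open>\<gamma>\<close> into drift \<open>- \<gamma>\<close>; the factor \<open>exp (2 * \<gamma> * y)\<close> is the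
  density that compensates for this, and without drift the function is the sign of \<open>y\<close>.\<close>

definition mirror_payoff :: "real \<Rightarrow> real \<Rightarrow> real" where
  "mirror_payoff \<gamma> y = (if 0 \<le> y then 1 else - exp (2 * \<gamma> * y))"

text \<open>The expectation of \<open>mirror_payoff \<gamma> (y - X t)\<close> for \<open>X t\<close> normal with mean \<open>\<gamma> * t\<close> and
  variance \<open>t\<close>. Scaling one standard normal variable keeps \<open>t = 0\<close> meaningful, which is the base
  case of the inductions over random walks. For \<open>\<gamma> \<ge> 0\<close>, \<open>y \<ge> 0\<close> and \<open>t > 0\<close> it turns
  out to be the probability that the drifted Brownian motion stays below \<open>y\<close> up to time \<open>t\<close>.\<close>

definition barrier_prob :: "real \<Rightarrow> real \<Rightarrow> real \<Rightarrow> real" where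
  "barrier_prob \<gamma> t y =
    (\<integral>z. mirror_payoff \<gamma> (y - (\<gamma> * t + sqrt t * z)) \<partial>std_normal_distribution)"

lemma mirror_payoff_measurable [measurable]: "mirror_payoff \<gamma> \<in> borel_measurable borel"
  unfolding mirror_payoff_def by measurable

lemma abs_mirror_payoff_le: "0 \<le> \<gamma> \<Longrightarrow> \<bar>mirror_payoff \<gamma> y\<bar> \<le> 1"
  by (auto simp: mirror_payoff_def mult_nonneg_nonpos)

lemma barrier_prob_measurable [measurable]: "barrier_prob \<gamma> t \<in> borel_measurable borel"
  unfolding barrier_prob_def by measurable

lemma abs_barrier_prob_le:
  assumes "0 \<le> \<gamma>"
  shows "\<bar>barrier_prob \<gamma> t y\<bar> \<le> 1"
proof -
  have "norm (barrier_prob \<gamma> t y) \<le> (\<integral>z. 1 \<partial>std_normal_distribution)"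
    unfolding barrier_prob_def
    by (rule Bochner_Integration.integral_norm_bound_integral)
       (auto intro!: std_normal.integrable_const_bound[where B = 1] abs_mirror_payoff_le assms)
  then show ?thesis using std_normal.prob_space by simp
qed

lemma barrier_prob_0: "barrier_prob \<gamma> 0 y = mirror_payoff \<gamma> y"
  using std_normal.prob_space by (simp add: barrier_prob_def)

lemma barrier_prob_semigroup:
  assumes "0 \<le> \<gamma>" "0 \<le> r" "0 \<le> t"
  shows "(\<integral>z. barrier_prob \<gamma> t (y - (\<gamma> * r + sqrt r * z)) \<partial>std_normal_distribution) =
    barrier_prob \<gamma> (r + t) y"
proof -
  have "(\<integral>z. barrier_prob \<gamma> t (y - (\<gamma> * r + sqrt r * z)) \<partial>std_normal_distribution) =
    (\<integral>x. (\<integral>z. mirror_payoff \<gamma> (y - (\<gamma> * (r + t) + (sqrt r * x + sqrt t * z)))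
      \<partial>std_normal_distribution) \<partial>std_normal_distribution)"
    unfolding barrier_prob_def by (simp add: algebra_simps)
  also have "\<dots> = barrier_prob \<gamma> (r + t) y"
    unfolding barrier_prob_def
    by (subst integral_std_normal_add[where C = 1])
       (use assms in \<open>auto intro: abs_mirror_payoff_le\<close>)
  finally show ?thesis .
qed

lemma barrier_prob_eq:
  assumes t: "0 < t"
  shows "barrier_prob \<gamma> t y =
    Phi ((y - \<gamma> * t) / sqrt t) - exp (2 * \<gamma> * y) * Phi (- (y + \<gamma> * t) / sqrt t)"
proof -
  define c where "c = (y - \<gamma> * t) / sqrt t"
  define m where "m = - 2 * \<gamma> * sqrt t"
  have st: "sqrt t > 0" "sqrt t * sqrt t = t" using t by auto
  have m2: "m\<^sup>2 / 2 = 2 * \<gamma>\<^sup>2 * t"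
    using t by (simp add: m_def power_mult_distrib)
  have int: "integrable std_normal_distribution (\<lambda>z. exp (m * z) * indicator {c<..} z)"
  proof -
    have "std_normal_density z * exp (m * z) = exp (m\<^sup>2 / 2) * normal_density m 1 z" for z
      by (simp add: normal_density_def exp_add[symmetric])
        (simp add: power2_eq_square field_simps)
    then have "integrable std_normal_distribution (\<lambda>z. exp (m * z))"
      by (subst integrable_density) auto
    from integrable_mult_indicator[OF _ this, of "{c<..}"] show ?thesis
      by (simp add: mult.commute)
  qed
  have "mirror_payoff \<gamma> (y - (\<gamma> * t + sqrt t * z)) =
      indicator {..c} z - exp (2 * \<gamma> * (y - \<gamma> * t)) * (exp (m * z) * indicator {c<..} z)" for z
  proof -
    have "0 \<le> y - (\<gamma> * t + sqrt t * z) \<longleftrightarrow> z \<le> c"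
      using st by (simp add: c_def field_simps)
    then show ?thesis
      by (auto simp: mirror_payoff_def m_def exp_add[symmetric] algebra_simps split: split_indicator)
  qed
  then have "barrier_prob \<gamma> t y = Phi c - exp (2 * \<gamma> * (y - \<gamma> * t)) *
      (\<integral>z. exp (m * z) * indicator {c<..} z \<partial>std_normal_distribution)"
    unfolding barrier_prob_def Phi_eq_integral
    by (simp only:, subst Bochner_Integration.integral_diff)
      (auto intro!: integrable_mult_right int std_normal.integrable_const_bound[where B = 1])
  also have "(\<integral>z. exp (m * z) * indicator {c<..} z \<partial>std_normal_distribution) =
      exp (m\<^sup>2 / 2) * (\<integral>z. indicator {c - m<..} z \<partial>std_normal_distribution)"
  proof -
    have "(\<lambda>z. indicator {c<..} (z + m) :: real) = indicator {c - m<..}"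
      by (rule ext) (auto split: split_indicator)
    then show ?thesis by (subst integral_std_normal_tilt) simp_all
  qed
  also have "(\<integral>z. indicator {c - m<..} z \<partial>std_normal_distribution) = Phi (- (c - m))"
  proof -
    have "(\<integral>z. indicator {c - m<..} z \<partial>std_normal_distribution) =
        (\<integral>z. 1 - indicator {..c - m} z \<partial>std_normal_distribution)"
      by (intro Bochner_Integration.integral_cong refl) (auto split: split_indicator)
    also have "\<dots> = 1 - Phi (c - m)"
      unfolding Phi_eq_integral
      by (subst Bochner_Integration.integral_diff)
        (auto intro!: std_normal.integrable_const_bound[where B = 1] simp: std_normal.prob_space[simplified])
    finally show ?thesis by (simp only: Phi_minus)
  qed
  also have "c - m = (y + \<gamma> * t) / sqrt t"
    using st by (simp add: c_def m_def field_simps)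
  also have "exp (2 * \<gamma> * (y - \<gamma> * t)) * (exp (m\<^sup>2 / 2) * Phi (- ((y + \<gamma> * t) / sqrt t))) =
      exp (2 * \<gamma> * y) * Phi (- (y + \<gamma> * t) / sqrt t)"
  proof -
    have "exp (2 * \<gamma> * (y - \<gamma> * t)) * exp (m\<^sup>2 / 2) = exp (2 * \<gamma> * y)"
      unfolding m2 exp_add[symmetric] by (simp add: algebra_simps power2_eq_square)
    then show ?thesis by (simp only: mult.assoc[symmetric] minus_divide_left)
  qed
  finally show ?thesis by (simp add: c_def)
qed

text \<open>This is the monotonicity of the ratio of \<open>Phi\<close> to its density, applied at \<open>- p - q\<close> and
  \<open>p - q\<close>. By the tilting formula the left-hand side is a Gaussian integral over the half-line up
  to \<open>p - q\<close> with a weight that is at most 1 there. It fixes the sign of \<open>barrier_prob\<close> and, for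
  \<open>p = q\<close>, bounds the Gaussian tail.\<close>

lemma exp_Phi_le:
  assumes "0 \<le> p"
  shows "exp (2 * p * q) * Phi (- p - q) \<le> Phi (p - q)"
proof -
  have "exp (2 * p\<^sup>2) * Phi (- p - q) =
      exp ((2 * p)\<^sup>2 / 2) * (\<integral>z. indicator {..p - q} (z + 2 * p) \<partial>std_normal_distribution)"
  proof -
    have "(\<lambda>z. indicator {..p - q} (z + 2 * p) :: real) = indicator {..- p - q}"
      by (rule ext) (auto split: split_indicator)
    then show ?thesis
      unfolding Phi_eq_integral by (simp only: power_mult_distrib) simp
  qed
  also have "\<dots> = (\<integral>z. exp (2 * p * z) * indicator {..p - q} z \<partial>std_normal_distribution)"
    by (subst integral_std_normal_tilt) auto
  also have "\<dots> \<le> (\<integral>z. exp (2 * p * (p - q)) * indicator {..p - q} z \<partial>std_normal_distribution)"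
  proof (rule Bochner_Integration.integral_mono)
    have le: "exp (2 * p * z) * indicator {..p - q} z \<le> exp (2 * p * (p - q)) * indicator {..p - q} z" for z
      using assms by (auto split: split_indicator intro!: mult_left_mono)
    then show "exp (2 * p * z) * indicator {..p - q} z \<le> exp (2 * p * (p - q)) * indicator {..p - q} z" for z .
    have bnd: "exp (2 * p * (p - q)) * indicator {..p - q} z \<le> exp (2 * p * (p - q))" for z
      by (auto split: split_indicator)
    have "norm (exp (2 * p * z) * indicator {..p - q} z) \<le> exp (2 * p * (p - q))" for z
      using order_trans[OF le bnd, of z] by simp
    then show "integrable std_normal_distribution (\<lambda>z. exp (2 * p * z) * indicator {..p - q} z)"
      by (intro std_normal.integrable_const_bound) auto
    show "integrable std_normal_distribution (\<lambda>z. exp (2 * p * (p - q)) * indicator {..p - q} z)"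
      using bnd by (intro std_normal.integrable_const_bound[where B = "exp (2 * p * (p - q))"]) auto
  qed
  also have "\<dots> = exp (2 * p\<^sup>2) * (exp (- (2 * p * q)) * Phi (p - q))"
  proof -
    have "exp (2 * p * (p - q)) = exp (2 * p\<^sup>2) * exp (- (2 * p * q))"
      unfolding exp_add[symmetric] by (simp add: power2_eq_square algebra_simps)
    then show ?thesis unfolding Phi_eq_integral by (simp only: integral_mult_right_zero mult.assoc)
  qed
  finally have "Phi (- p - q) \<le> exp (- (2 * p * q)) * Phi (p - q)"
    by (rule mult_left_le_imp_le) simp
  then have "exp (2 * p * q) * Phi (- p - q) \<le> exp (2 * p * q) * (exp (- (2 * p * q)) * Phi (p - q))"
    by (rule mult_left_mono) simp
  also have "\<dots> = Phi (p - q)"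
    by (simp only: mult.assoc[symmetric] exp_add[symmetric]) simp
  finally show ?thesis .
qed

lemma barrier_prob_nonneg:
  assumes "0 \<le> t" "0 \<le> y"
  shows "0 \<le> barrier_prob \<gamma> t y"
proof (cases "t = 0")
  case True
  then show ?thesis using assms by (simp add: barrier_prob_0 mirror_payoff_def)
next
  case False
  define p q where "p = y / sqrt t" and "q = \<gamma> * sqrt t"
  have "sqrt t > 0" "sqrt t * sqrt t = t" using False assms by auto
  then have "(y - \<gamma> * t) / sqrt t = p - q" "- (y + \<gamma> * t) / sqrt t = - p - q" "p * q = \<gamma> * y" "p \<ge> 0"
    using assms by (auto simp: p_def q_def field_simps)
  with exp_Phi_le[of p q] show ?thesis
    using False assms by (simp add: barrier_prob_eq mult.assoc)
qed

lemma barrier_prob_nonpos: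
  assumes "0 \<le> t" "y < 0"
  shows "barrier_prob \<gamma> t y \<le> 0"
proof (cases "t = 0")
  case True
  then show ?thesis using assms by (simp add: barrier_prob_0 mirror_payoff_def)
next
  case False
  define p q where "p = - y / sqrt t" and "q = \<gamma> * sqrt t"
  have "sqrt t > 0" "sqrt t * sqrt t = t" using False assms by auto
  then have *: "(y - \<gamma> * t) / sqrt t = - p - q" "- (y + \<gamma> * t) / sqrt t = p - q"
      "2 * p * q = - (2 * \<gamma> * y)" "p \<ge> 0"
    using assms by (auto simp: p_def q_def field_simps)
  have "exp (2 * \<gamma> * y) * (exp (- (2 * \<gamma> * y)) * Phi (- p - q)) \<le> exp (2 * \<gamma> * y) * Phi (p - q)"
    using exp_Phi_le[of p q] * by (intro mult_left_mono) simp_all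
  then have "Phi (- p - q) \<le> exp (2 * \<gamma> * y) * Phi (p - q)"
    by (simp only: mult.assoc[symmetric] exp_add[symmetric]) simp
  moreover have "0 < t" using False assms by simp
  ultimately show ?thesis
    by (simp only: barrier_prob_eq * diff_le_0_iff_le)
qed

lemma Phi_tail_le:
  assumes "0 \<le> x"
  shows "Phi (- x) \<le> exp (- (x\<^sup>2 / 2))"
proof -
  have "exp (x\<^sup>2 / 2) * Phi (- x) \<le> Phi 0"
    using exp_Phi_le[of "x / 2" "x / 2"] assms by (simp add: power2_eq_square)
  also have "Phi 0 \<le> 1"
    unfolding Phi_def by (rule std_normal.cdf_bounded_prob)
  finally show ?thesis
    by (simp add: exp_minus field_simps)
qed

section \<open>Gaussian random walks below a level\<close>

definition step_law :: "real \<Rightarrow> real \<Rightarrow> real measure" where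
  "step_law \<gamma> d = distr std_normal_distribution borel (\<lambda>z. \<gamma> * d + sqrt d * z)"

text \<open>\<open>survival \<mu> n y\<close> is the probability that the walk with independent \<open>\<mu>\<close>-distributed steps,
  started at 0, is at most \<open>y\<close> at the times \<open>0, \<dots>, n\<close>. Splitting off the first step rather than the last
  one makes \<open>y\<close> the only state, and the recursion is that of \<open>barrier_prob\<close> with killing below 0.\<close>

primrec survival :: "real measure \<Rightarrow> nat \<Rightarrow> real \<Rightarrow> real" where
  "survival \<mu> 0 y = indicator {0..} y"
| "survival \<mu> (Suc n) y = indicator {0..} y * (\<integral>z. survival \<mu> n (y - z) \<partial>\<mu>)"

lemma step_law_space: "sets (step_law \<gamma> d) = sets borel" "prob_space (step_law \<gamma> d)"
  unfolding step_law_def by (auto intro!: std_normal.prob_space_distr)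

lemma survival_measurable:
  assumes \<mu>: "prob_space \<mu>" "sets \<mu> = sets borel"
  shows "survival \<mu> n \<in> borel_measurable borel"
proof (induction n)
  case (Suc n)
  interpret prob_space \<mu> by fact
  note [measurable] = Suc
  note [measurable_cong] = \<mu>(2)
  show ?case by simp
qed simp

lemma survival_bounds:
  assumes \<mu>: "prob_space \<mu>" "sets \<mu> = sets borel"
  shows "0 \<le> survival \<mu> n y \<and> survival \<mu> n y \<le> 1"
proof (induction n arbitrary: y)
  case (Suc n)
  interpret prob_space \<mu> by fact
  note [measurable_cong] = \<mu>(2)
  note [measurable] = survival_measurable[OF \<mu>]
  have "integrable \<mu> (\<lambda>z. survival \<mu> n (y - z))"
    by (rule integrable_const_bound[where B = 1]) (use Suc in auto)
  then have "(\<integral>z. survival \<mu> n (y - z) \<partial>\<mu>) \<le> (\<integral>z. 1 \<partial>\<mu>)"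
    by (rule integral_mono) (use Suc in auto)
  moreover have "0 \<le> (\<integral>z. survival \<mu> n (y - z) \<partial>\<mu>)"
    by (rule Bochner_Integration.integral_nonneg) (use Suc in auto)
  ultimately show ?case by (auto simp: prob_space split: split_indicator)
qed (auto split: split_indicator)

lemma survival_integrable:
  assumes \<mu>: "prob_space \<mu>" "sets \<mu> = sets borel"
  shows "integrable \<mu> (\<lambda>z. survival \<mu> n (y - z))"
proof -
  interpret prob_space \<mu> by fact
  note [measurable_cong] = \<mu>(2)
  note [measurable] = survival_measurable[OF \<mu>]
  show ?thesis
    by (rule integrable_const_bound[where B = 1]) (use survival_bounds[OF \<mu>] in auto)
qed

lemma survival_negative: "y < 0 \<Longrightarrow> survival \<mu> n y = 0"
  by (cases n) auto

text \<open>The index interval starts at an arbitrary \<open>m\<close> because splitting off the first coordinate leaves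
  a product over \<open>{Suc m..<Suc m + n}\<close>.\<close>

lemma emeasure_PiM_partial_sums_le:
  assumes \<mu>: "prob_space \<mu>" "sets \<mu> = sets borel"
  shows "emeasure (PiM {m..<m + n} (\<lambda>_. \<mu>))
      {f \<in> space (PiM {m..<m + n} (\<lambda>_. \<mu>)). \<forall>k\<in>{m..m + n}. (\<Sum>i=m..<k. f i) \<le> y} =
    ennreal (survival \<mu> n y)"
proof (induction n arbitrary: m y)
  case 0
  show ?case by (auto simp: space_PiM PiM_empty split: split_indicator)
next
  case (Suc n)
  interpret prob_space \<mu> by fact
  interpret product_sigma_finite "\<lambda>_. \<mu>" by standard
  note [measurable_cong] = \<mu>(2)
  let ?P = "\<lambda>I. PiM I (\<lambda>_::nat. \<mu>)"
  let ?A = "{f \<in> space (?P {m..<m + Suc n}). \<forall>k\<in>{m..m + Suc n}. (\<Sum>i=m..<k. f i) \<le> y}"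
  let ?B = "\<lambda>y. {f \<in> space (?P {Suc m..<Suc m + n}). \<forall>k\<in>{Suc m..Suc m + n}. (\<Sum>i=Suc m..<k. f i) \<le> y}"
  have ins: "{m..<m + Suc n} = insert m {Suc m..<Suc m + n}" by auto
  have A[measurable]: "?A \<in> sets (?P {m..<m + Suc n})"
    by measurable
  have B[measurable]: "?B y \<in> sets (?P {Suc m..<Suc m + n})" for y
    by measurable
  have upd: "indicator ?A (x(m := z)) = (indicator {0..} y * indicator (?B (y - z)) x :: ennreal)"
    if x: "x \<in> space (?P {Suc m..<Suc m + n})" and z: "z \<in> space \<mu>" for x z
  proof -
    have sp: "x(m := z) \<in> space (?P {m..<m + Suc n})"
      using x z unfolding ins space_PiM by (auto simp: PiE_def extensional_def)
    have sum: "(\<Sum>i=m..<k. (x(m := z)) i) = z + (\<Sum>i=Suc m..<k. x i)" if "k \<ge> Suc m" for k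
      using that by (subst sum.atLeast_Suc_lessThan) auto
    have ks: "{m..m + Suc n} = insert m {Suc m..Suc m + n}" by auto
    have "(\<forall>k\<in>{m..m + Suc n}. (\<Sum>i=m..<k. (x(m := z)) i) \<le> y) \<longleftrightarrow>
        0 \<le> y \<and> (\<forall>k\<in>{Suc m..Suc m + n}. (\<Sum>i=Suc m..<k. x i) \<le> y - z)"
      unfolding ks using sum by (auto simp: algebra_simps)
    then show ?thesis using sp x by (auto split: split_indicator)
  qed
  have "emeasure (?P {m..<m + Suc n}) ?A = (\<integral>\<^sup>+f. indicator ?A f \<partial>?P {m..<m + Suc n})"
    by simp
  also have "\<dots> = (\<integral>\<^sup>+z. (\<integral>\<^sup>+x. indicator ?A (x(m := z)) \<partial>?P {Suc m..<Suc m + n}) \<partial>\<mu>)"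
    unfolding ins
    by (rule product_nn_integral_insert_rev) (use A in \<open>simp_all only: ins borel_measurable_indicator\<close>, simp_all)
  also have "\<dots> = (\<integral>\<^sup>+z. (\<integral>\<^sup>+x. indicator {0..} y * indicator (?B (y - z)) x \<partial>?P {Suc m..<Suc m + n}) \<partial>\<mu>)"
    by (intro nn_integral_cong upd)
  also have "\<dots> = (\<integral>\<^sup>+z. indicator {0..} y * ennreal (survival \<mu> n (y - z)) \<partial>\<mu>)"
    by (intro nn_integral_cong) (subst nn_integral_cmult, use Suc[of "Suc m"] in auto)
  also have "\<dots> = indicator {0..} y * (\<integral>\<^sup>+z. ennreal (survival \<mu> n (y - z)) \<partial>\<mu>)"
    using survival_measurable[OF \<mu>] by (intro nn_integral_cmult) simp
  also have "(\<integral>\<^sup>+z. ennreal (survival \<mu> n (y - z)) \<partial>\<mu>) = ennreal (\<integral>z. survival \<mu> n (y - z) \<partial>\<mu>)"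
    by (rule nn_integral_eq_integral) (use survival_integrable[OF \<mu>] survival_bounds[OF \<mu>] in auto)
  finally show ?case by (auto split: split_indicator)
qed

lemma integral_step_law_barrier_prob:
  assumes "0 \<le> \<gamma>" "0 \<le> d"
  shows "(\<integral>z. barrier_prob \<gamma> (real n * d) (y - z) \<partial>step_law \<gamma> d) = barrier_prob \<gamma> (real (Suc n) * d) y"
proof -
  have "(\<integral>z. barrier_prob \<gamma> (real n * d) (y - z) \<partial>step_law \<gamma> d) = barrier_prob \<gamma> (d + real n * d) y"
    unfolding step_law_def
    by (subst integral_distr) (use assms in \<open>auto intro!: barrier_prob_semigroup\<close>)
  then show ?thesis by (simp add: algebra_simps)
qed

lemma integrable_step_law_barrier_prob:
  assumes "0 \<le> \<gamma>"
  shows "integrable (step_law \<gamma> d) (\<lambda>z. barrier_prob \<gamma> t (y - z))"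
proof -
  interpret prob_space "step_law \<gamma> d" by (rule step_law_space)
  note [measurable_cong] = step_law_space(1)
  show ?thesis
    by (rule integrable_const_bound[where B = 1]) (use abs_barrier_prob_le[OF assms] in auto)
qed

text \<open>Both sides satisfy the same recursion where \<open>y \<ge> 0\<close>; where \<open>y < 0\<close>, the right-hand side is 0
  and the left-hand side is not positive.\<close>

lemma barrier_prob_le_survival:
  assumes "0 \<le> \<gamma>" "0 \<le> d"
  shows "barrier_prob \<gamma> (real n * d) y \<le> survival (step_law \<gamma> d) n y"
proof (induction n arbitrary: y)
  case 0
  show ?case by (auto simp: barrier_prob_0 mirror_payoff_def split: split_indicator)
next
  case (Suc n)
  note S = step_law_space(2,1)[of \<gamma> d]
  show ?case
  proof (cases "0 \<le> y")
    case True
    have "barrier_prob \<gamma> (real (Suc n) * d) y = (\<integral>z. barrier_prob \<gamma> (real n * d) (y - z) \<partial>step_law \<gamma> d)"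
      by (rule integral_step_law_barrier_prob[symmetric]) (use assms in auto)
    also have "\<dots> \<le> (\<integral>z. survival (step_law \<gamma> d) n (y - z) \<partial>step_law \<gamma> d)"
      by (intro integral_mono survival_integrable[OF S] integrable_step_law_barrier_prob assms Suc)
    finally show ?thesis using True by simp
  next
    case False
    then show ?thesis using barrier_prob_nonpos[of "real (Suc n) * d" y] assms by simp
  qed
qed

text \<open>At the raised level \<open>y + \<epsilon>\<close> the comparison function is nonnegative unless the walk overshoots
  \<open>y\<close> by more than \<open>\<epsilon>\<close>, which takes a single step larger than \<open>\<epsilon>\<close>. In that event it is still at
  least \<open>- 1\<close>, so each of the \<open>n\<close> steps costs at most the probability of such a step.\<close>

lemma survival_le_barrier_prob:
  assumes \<gamma>: "0 \<le> \<gamma>" and d: "0 \<le> d" and "0 < \<epsilon>" and "- \<epsilon> \<le> y"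
  shows "survival (step_law \<gamma> d) n y \<le>
    barrier_prob \<gamma> (real n * d) (y + \<epsilon>) + real n * measure (step_law \<gamma> d) {\<epsilon><..}"
  using \<open>- \<epsilon> \<le> y\<close>
proof (induction n arbitrary: y)
  case 0
  then show ?case by (auto simp: barrier_prob_0 mirror_payoff_def split: split_indicator)
next
  case (Suc n)
  note S = step_law_space(2,1)[of \<gamma> d]
  interpret prob_space "step_law \<gamma> d" by (rule step_law_space)
  note [measurable_cong] = step_law_space(1)
  define p where "p = measure (step_law \<gamma> d) {\<epsilon><..}"
  have sp: "space (step_law \<gamma> d) = UNIV" by (simp add: step_law_def)
  have p0: "p \<ge> 0" by (simp add: p_def)
  show ?case
  proof (cases "0 \<le> y")
    case True
    have le: "survival (step_law \<gamma> d) n (y - z) \<le>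
        barrier_prob \<gamma> (real n * d) (y + \<epsilon> - z) + real n * p + indicator {\<epsilon><..} z" for z
    proof (cases "- \<epsilon> \<le> y - z")
      case True
      then have "survival (step_law \<gamma> d) n (y - z) \<le> barrier_prob \<gamma> (real n * d) (y + \<epsilon> - z) + real n * p"
        using Suc.IH[OF True] by (simp add: algebra_simps p_def)
      then show ?thesis by (auto split: split_indicator)
    next
      case False
      then have "z > \<epsilon>" using \<open>0 \<le> y\<close> by simp
      moreover have "survival (step_law \<gamma> d) n (y - z) = 0"
        using False \<open>0 < \<epsilon>\<close> by (intro survival_negative) simp
      moreover have "- 1 \<le> barrier_prob \<gamma> (real n * d) (y + \<epsilon> - z)"
        using abs_barrier_prob_le[OF \<gamma>, of "real n * d" "y + \<epsilon> - z"] by linarith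
      moreover have "0 \<le> real n * p" using p0 by simp
      moreover have "indicator {\<epsilon><..} z = (1::real)" using \<open>z > \<epsilon>\<close> by simp
      ultimately show ?thesis by linarith
    qed
    have int_u: "integrable (step_law \<gamma> d) (\<lambda>z. barrier_prob \<gamma> (real n * d) (y + \<epsilon> - z))"
      by (rule integrable_step_law_barrier_prob[OF \<gamma>])
    have int_ind: "integrable (step_law \<gamma> d) (indicator {\<epsilon><..} :: real \<Rightarrow> real)"
      by (rule integrable_const_bound[where B = 1]) auto
    have int_p: "integrable (step_law \<gamma> d) (\<lambda>z. real n * p)"
      by (rule integrable_const)
    note int_up = Bochner_Integration.integrable_add[OF int_u int_p]
    have "(\<integral>z. survival (step_law \<gamma> d) n (y - z) \<partial>step_law \<gamma> d) \<le>
        (\<integral>z. barrier_prob \<gamma> (real n * d) (y + \<epsilon> - z) + real n * p + indicator {\<epsilon><..} z \<partial>step_law \<gamma> d)"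
      by (rule integral_mono[OF survival_integrable[OF S] Bochner_Integration.integrable_add[OF int_up int_ind] le])
    also have "\<dots> = barrier_prob \<gamma> (real (Suc n) * d) (y + \<epsilon>) + real n * p + p"
      unfolding Bochner_Integration.integral_add[OF int_up int_ind]
        Bochner_Integration.integral_add[OF int_u int_p]
        integral_step_law_barrier_prob[OF \<gamma> d]
      by (simp add: p_def sp prob_space[unfolded sp])
    finally show ?thesis using True by (simp add: p_def algebra_simps)
  next
    case False
    then show ?thesis
      using barrier_prob_nonneg[of "real (Suc n) * d" "y + \<epsilon>" \<gamma>] d Suc.prems by simp
  qed
qed

lemma step_law_tail:
  assumes "0 < d" "\<gamma> * d \<le> \<epsilon>"
  shows "measure (step_law \<gamma> d) {\<epsilon><..} \<le> exp (- (((\<epsilon> - \<gamma> * d) / sqrt d)\<^sup>2 / 2))"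
proof -
  define c where "c = (\<epsilon> - \<gamma> * d) / sqrt d"
  have "measure (step_law \<gamma> d) {\<epsilon><..} = measure std_normal_distribution {z. \<epsilon> < \<gamma> * d + sqrt d * z}"
    unfolding step_law_def by (subst measure_distr) (auto simp: vimage_def)
  also have "{z. \<epsilon> < \<gamma> * d + sqrt d * z} = - {..c}"
    using assms by (auto simp: c_def field_simps)
  also have "measure std_normal_distribution (- {..c}) = Phi (- c)"
    using std_normal.prob_compl[of "{..c}"]
    by (simp only: Phi_minus) (simp add: Phi_def cdf_def Compl_eq_Diff_UNIV)
  also have "\<dots> \<le> exp (- (c\<^sup>2 / 2))"
    by (rule Phi_tail_le) (use assms in \<open>simp add: c_def\<close>)
  finally show ?thesis by (simp add: c_def)
qed

text \<open>The union bound over \<open>n\<close> steps loses a factor \<open>n\<close>, while the tail of one step of variance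
  \<open>t / n\<close> decays exponentially in \<open>n\<close>.\<close>

lemma step_law_tails_vanish:
  assumes "0 \<le> \<gamma>" "0 < t" "0 < \<epsilon>"
  shows "(\<lambda>n. real n * measure (step_law \<gamma> (t / real n)) {\<epsilon><..}) \<longlonglongrightarrow> 0"
proof (rule tendsto_sandwich[OF _ _ tendsto_const])
  have lim: "(\<lambda>n. \<gamma> * (t / real n)) \<longlonglongrightarrow> 0" by real_asymp
  show "\<forall>\<^sub>F n in sequentially. real n * measure (step_law \<gamma> (t / real n)) {\<epsilon><..} \<le>
      real n * exp (- (((\<epsilon> - \<gamma> * (t / real n)) / sqrt (t / real n))\<^sup>2 / 2))"
    using order_tendstoD(2)[OF lim \<open>0 < \<epsilon>\<close>] eventually_gt_at_top[of 0]
    by eventually_elim (intro mult_left_mono step_law_tail, use assms in auto)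
  show "(\<lambda>n. real n * exp (- (((\<epsilon> - \<gamma> * (t / real n)) / sqrt (t / real n))\<^sup>2 / 2))) \<longlonglongrightarrow> 0"
  proof -
    have "(\<lambda>n. real n * exp (- ((\<epsilon> - \<gamma> * (t / real n))\<^sup>2 * real n / (2 * t)))) \<longlonglongrightarrow> 0"
      using assms by real_asymp
    moreover have "((\<epsilon> - \<gamma> * (t / real n)) / sqrt (t / real n))\<^sup>2 / 2 =
        (\<epsilon> - \<gamma> * (t / real n))\<^sup>2 * real n / (2 * t)" for n
      using assms by (simp add: power_divide)
    ultimately show ?thesis by presburger
  qed
qed (auto intro!: always_eventually)

lemma barrier_prob_isCont:
  assumes "0 < t"
  shows "isCont (barrier_prob \<gamma> t) y"
  unfolding barrier_prob_eq[OF assms] using assms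
  by (auto intro!: continuous_intros isCont_o2[OF _ DERIV_isCont[OF Phi_has_real_derivative]])

lemma survival_tendsto:
  assumes \<gamma>: "0 \<le> \<gamma>" and t: "0 < t" and y: "0 \<le> y"
  shows "(\<lambda>n. survival (step_law \<gamma> (t / real n)) n y) \<longlonglongrightarrow> barrier_prob \<gamma> t y"
proof (rule order_tendstoI)
  fix c assume "c < barrier_prob \<gamma> t y"
  then have "c < survival (step_law \<gamma> (t / real n)) n y" if "0 < n" for n
    using barrier_prob_le_survival[OF \<gamma>, of "t / real n" n y] t that by simp
  then show "\<forall>\<^sub>F n in sequentially. c < survival (step_law \<gamma> (t / real n)) n y"
    unfolding eventually_at_top_linorder by (intro exI[of _ 1]) simp
next
  \<comment> \<open>Fix the raise of the level by continuity in \<open>y\<close> before the grid is refined.\<close>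
  fix c assume c: "barrier_prob \<gamma> t y < c"
  have "((\<lambda>\<epsilon>. barrier_prob \<gamma> t (y + \<epsilon>)) \<longlongrightarrow> barrier_prob \<gamma> t (y + 0)) (at_right 0)"
    by (intro isCont_tendsto_compose[OF barrier_prob_isCont] tendsto_intros t)
  with c have "\<forall>\<^sub>F \<epsilon> in at_right 0. barrier_prob \<gamma> t (y + \<epsilon>) < c"
    by (intro order_tendstoD) auto
  then have "\<forall>\<^sub>F \<epsilon> in at_right 0. 0 < \<epsilon> \<and> barrier_prob \<gamma> t (y + \<epsilon>) < c"
    using eventually_at_right_less by (rule eventually_conj[rotated])
  then obtain \<epsilon> where \<epsilon>: "0 < \<epsilon>" "barrier_prob \<gamma> t (y + \<epsilon>) < c"
    using eventually_happens' trivial_limit_at_right_real by blast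
  have "(\<lambda>n. barrier_prob \<gamma> t (y + \<epsilon>) + real n * measure (step_law \<gamma> (t / real n)) {\<epsilon><..})
      \<longlonglongrightarrow> barrier_prob \<gamma> t (y + \<epsilon>) + 0"
    by (intro tendsto_intros step_law_tails_vanish \<gamma> t \<epsilon>)
  with \<epsilon>(2) have "\<forall>\<^sub>F n in sequentially.
      barrier_prob \<gamma> t (y + \<epsilon>) + real n * measure (step_law \<gamma> (t / real n)) {\<epsilon><..} < c"
    by (intro order_tendstoD) auto
  then show "\<forall>\<^sub>F n in sequentially. survival (step_law \<gamma> (t / real n)) n y < c"
    using eventually_gt_at_top[of 0]
  proof eventually_elim
    case (elim n)
    then show ?case
      using survival_le_barrier_prob[OF \<gamma>, of "t / real n" \<epsilon> y n] t y \<epsilon>(1) by simp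
  qed
qed

section \<open>The maximum of a drifted Brownian motion\<close>

lemma dyadic_dense:
  fixes t :: real
  assumes "0 < t" "0 \<le> s" "s \<le> t"
  obtains k :: "nat \<Rightarrow> nat" where "\<And>j. k j \<le> 2 ^ j"
    "(\<lambda>j. real (k j) * (t / 2 ^ j)) \<longlonglongrightarrow> s"
proof
  let ?k = "\<lambda>j::nat. nat \<lfloor>s * 2 ^ j / t\<rfloor>"
  have nn: "0 \<le> s * 2 ^ j / t" for j :: nat using assms by simp
  have k: "real (?k j) = real_of_int \<lfloor>s * 2 ^ j / t\<rfloor>" for j
    using nn[of j] by simp
  show "?k j \<le> 2 ^ j" for j
  proof -
    have "s * 2 ^ j / t \<le> real (2 ^ j)" using assms by (simp add: field_simps)
    then have "real (?k j) \<le> real (2 ^ j)" unfolding k using of_int_floor_le[of "s * 2 ^ j / t"] by linarith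
    then show ?thesis by (simp only: of_nat_le_iff)
  qed
  have ub: "real (?k j) * (t / 2 ^ j) \<le> s" for j
  proof -
    have "real (?k j) * (t / 2 ^ j) \<le> (s * 2 ^ j / t) * (t / 2 ^ j)"
      unfolding k by (rule mult_right_mono) (use assms in auto)
    then show ?thesis using assms by simp
  qed
  have lb: "s - t / 2 ^ j \<le> real (?k j) * (t / 2 ^ j)" for j
  proof -
    have "(s * 2 ^ j / t - 1) * (t / 2 ^ j) \<le> real (?k j) * (t / 2 ^ j)"
      unfolding k by (rule mult_right_mono) (linarith, use assms in simp)
    moreover have "(s * 2 ^ j / t - 1) * (t / 2 ^ j) = s - t / 2 ^ j"
      using assms by (simp add: left_diff_distrib diff_divide_distrib)
    ultimately show ?thesis by simp
  qed
  have lim: "(\<lambda>j::nat. s - t / 2 ^ j) \<longlonglongrightarrow> s" by real_asymp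
  show "(\<lambda>j. real (?k j) * (t / 2 ^ j)) \<longlonglongrightarrow> s"
    by (rule tendsto_sandwich[OF _ _ lim tendsto_const]) (use ub lb in \<open>auto intro!: always_eventually\<close>)
qed

context standard_brownian_motion
begin

lemma prob_grid_below:
  assumes t: "0 < t" and n: "0 < n"
  shows "prob {\<omega> \<in> space M. \<forall>k\<le>n. B (real k * (t / real n)) \<omega> - B 0 \<omega> + \<gamma> * (real k * (t / real n)) \<le> y} =
    survival (step_law \<gamma> (t / real n)) n y"
proof -
  define d where "d = t / real n"
  have d: "d > 0" using t n by (simp add: d_def)
  define \<tau> where "\<tau> i = real i * d" for i :: nat
  define \<xi> where "\<xi> i \<omega> = B (\<tau> (Suc i)) \<omega> - B (\<tau> i) \<omega> + \<gamma> * d" for i \<omega>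
  have [measurable]: "B (\<tau> i) \<in> borel_measurable M" for i
    by (rule measurable) (use d in \<open>simp add: \<tau>_def\<close>)
  have \<xi>[measurable]: "\<xi> i \<in> borel_measurable M" for i
    unfolding \<xi>_def by measurable
  have law: "distr M borel (\<xi> i) = step_law \<gamma> d" for i
  proof -
    have "distributed M lborel (\<lambda>\<omega>. B (\<tau> (Suc i)) \<omega> - B (\<tau> i) \<omega>)
        (normal_density 0 (sqrt (\<tau> (Suc i) - \<tau> i)))"
      by (rule normal_increments) (use d in \<open>auto simp: \<tau>_def\<close>)
    then have "distributed M lborel (\<lambda>\<omega>. \<gamma> * d + 1 * (B (\<tau> (Suc i)) \<omega> - B (\<tau> i) \<omega>))
        (normal_density (\<gamma> * d + 1 * 0) (\<bar>1\<bar> * sqrt (\<tau> (Suc i) - \<tau> i)))"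
      by (rule normal_density_affine) (use d in \<open>auto simp: \<tau>_def\<close>)
    moreover have "\<tau> (Suc i) - \<tau> i = d" by (simp add: \<tau>_def algebra_simps)
    ultimately have "distributed M lborel (\<xi> i) (normal_density (\<gamma> * d) (sqrt d))"
      by (simp add: \<xi>_def[abs_def] add.commute)
    then have "distr M lborel (\<xi> i) = density lborel (normal_density (\<gamma> * d) (sqrt d))"
      by (rule distributed_distr_eq_density)
    moreover have "distr M borel (\<xi> i) = distr M lborel (\<xi> i)"
      by (rule distr_cong) auto
    ultimately show ?thesis
      unfolding step_law_def using distr_std_normal_scale[of "sqrt d" "\<gamma> * d"] d by simp
  qed
  have "indep_vars (\<lambda>_. borel) (\<lambda>i \<omega>. B (\<tau> (Suc i)) \<omega> - B (\<tau> i) \<omega>) {..<n}"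
    by (rule indep_increments) (use d in \<open>auto simp: \<tau>_def\<close>)
  then have "indep_vars (\<lambda>_. borel) \<xi> {..<n}"
    unfolding \<xi>_def[abs_def] by (rule indep_vars_compose2[where Y = "\<lambda>_ x. x + \<gamma> * d"]) auto
  then have joint: "distr M (Pi\<^sub>M {..<n} (\<lambda>_. borel)) (\<lambda>\<omega>. \<lambda>i\<in>{..<n}. \<xi> i \<omega>) = Pi\<^sub>M {..<n} (\<lambda>_. step_law \<gamma> d)"
    by (subst (asm) indep_vars_iff_distr_eq_PiM) (use n in \<open>auto simp: law\<close>)
  let ?P = "Pi\<^sub>M {..<n} (\<lambda>_. borel :: real measure)"
  let ?A = "{f \<in> space ?P. \<forall>k\<in>{0..n}. (\<Sum>i=0..<k. f i) \<le> y}"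
  have sets: "sets (Pi\<^sub>M {..<n} (\<lambda>_. step_law \<gamma> d)) = sets ?P"
    by (intro sets_PiM_cong refl step_law_space)
  have A[measurable]: "?A \<in> sets ?P"
  proof -
    \<comment> \<open>The sums run over \<open>{0..<k}\<close>, and measurability is found once the index sets match.\<close>
    have "{..<n} = {0..<n}" by auto
    then show ?thesis by (simp only:) measurable
  qed
  have sum: "(\<Sum>i=0..<k. \<xi> i \<omega>) = B (\<tau> k) \<omega> - B 0 \<omega> + \<gamma> * \<tau> k" for k \<omega>
    by (induction k) (auto simp: \<xi>_def \<tau>_def algebra_simps)
  have "prob {\<omega> \<in> space M. \<forall>k\<le>n. B (\<tau> k) \<omega> - B 0 \<omega> + \<gamma> * \<tau> k \<le> y} =
      prob ((\<lambda>\<omega>. \<lambda>i\<in>{..<n}. \<xi> i \<omega>) -` ?A \<inter> space M)"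
  proof (rule arg_cong[where f = prob], rule set_eqI)
    fix \<omega>
    have "(\<Sum>i=0..<k. (\<lambda>i\<in>{..<n}. \<xi> i \<omega>) i) = B (\<tau> k) \<omega> - B 0 \<omega> + \<gamma> * \<tau> k" if "k \<le> n" for k
      unfolding sum[symmetric] using that by (intro sum.cong) auto
    then show "(\<omega> \<in> {\<omega> \<in> space M. \<forall>k\<le>n. B (\<tau> k) \<omega> - B 0 \<omega> + \<gamma> * \<tau> k \<le> y}) \<longleftrightarrow>
        (\<omega> \<in> (\<lambda>\<omega>. \<lambda>i\<in>{..<n}. \<xi> i \<omega>) -` ?A \<inter> space M)"
      by (auto simp: space_PiM)
  qed
  also have "\<dots> = measure (distr M ?P (\<lambda>\<omega>. \<lambda>i\<in>{..<n}. \<xi> i \<omega>)) ?A"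
    by (subst measure_distr) (auto intro!: measurable_restrict A)
  also have "\<dots> = measure (Pi\<^sub>M {..<n} (\<lambda>_. step_law \<gamma> d)) ?A"
    by (simp only: joint)
  also have "\<dots> = survival (step_law \<gamma> d) n y"
  proof -
    have "space (Pi\<^sub>M {..<n} (\<lambda>_. step_law \<gamma> d)) = space ?P"
      by (rule sets_eq_imp_space_eq) (rule sets)
    moreover have "{..<n} = {0..<n}" by auto
    ultimately have "emeasure (Pi\<^sub>M {..<n} (\<lambda>_. step_law \<gamma> d)) ?A = ennreal (survival (step_law \<gamma> d) n y)"
      using emeasure_PiM_partial_sums_le[OF step_law_space(2,1), of 0 n \<gamma> d y] by simp
    then show ?thesis
      using survival_bounds[OF step_law_space(2,1)] by (simp add: measure_def)
  qed
  finally show ?thesis by (simp add: \<tau>_def d_def)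
qed

text \<open>The set of paths below \<open>y\<close> is an uncountable intersection and need not be an event; it agrees
  almost surely with the event \<open>E\<close> that the path is below \<open>y\<close> at all dyadic multiples of \<open>t\<close>. Dyadic
  grids are nested, so continuity from above applies to the probabilities of the grid events.\<close>

lemma prob_path_below:
  assumes t: "0 < t" and y: "0 \<le> y" and \<gamma>: "0 \<le> \<gamma>"
  obtains E where "E \<in> events" "prob E = barrier_prob \<gamma> t y"
    "AE \<omega> in M. \<omega> \<in> E \<longleftrightarrow> (\<forall>s\<in>{0..t}. B s \<omega> + \<gamma> * s \<le> y)"
proof
  define g where "g j k = real k * (t / 2 ^ j)" for j k :: nat
  define E where "E j = {\<omega> \<in> space M. \<forall>k\<le>2^j. B (g j k) \<omega> - B 0 \<omega> + \<gamma> * g j k \<le> y}" for j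
  have g0: "0 \<le> g j k" for j k using t by (simp add: g_def)
  have [measurable]: "B (g j k) \<in> borel_measurable M" "B 0 \<in> borel_measurable M" for j k
    by (auto intro!: measurable g0)
  have E[measurable]: "E j \<in> events" for j
    unfolding E_def by measurable
  then show "(\<Inter>j. E j) \<in> events" by blast
  have "decseq E"
  proof (rule decseq_SucI, rule subsetI)
    fix j \<omega> assume \<omega>: "\<omega> \<in> E (Suc j)"
    have "g j k = g (Suc j) (2 * k)" for k by (simp add: g_def)
    then show "\<omega> \<in> E j" using \<omega> unfolding E_def by auto
  qed
  then have "(\<lambda>j. prob (E j)) \<longlonglongrightarrow> prob (\<Inter>j. E j)"
    by (intro finite_Lim_measure_decseq) auto
  moreover have "(\<lambda>j. prob (E j)) \<longlonglongrightarrow> barrier_prob \<gamma> t y"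
  proof -
    have "prob (E j) = survival (step_law \<gamma> (t / real (2 ^ j))) (2 ^ j) y" for j
      using prob_grid_below[OF t, of "2 ^ j" \<gamma> y] by (simp add: E_def g_def)
    moreover have "filterlim (\<lambda>j::nat. 2 ^ j :: nat) at_top sequentially"
      by (rule filterlim_subseq) (simp add: strict_mono_def)
    ultimately show ?thesis
      using filterlim_compose[OF survival_tendsto[OF \<gamma> t y]] by (simp only:)
  qed
  ultimately show "prob (\<Inter>j. E j) = barrier_prob \<gamma> t y"
    by (rule LIMSEQ_unique)
  show "AE \<omega> in M. \<omega> \<in> (\<Inter>j. E j) \<longleftrightarrow> (\<forall>s\<in>{0..t}. B s \<omega> + \<gamma> * s \<le> y)"
    using start_zero continuous_paths AE_space
  proof eventually_elim
    case (elim \<omega>)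
    have "\<omega> \<in> (\<Inter>j. E j) \<longleftrightarrow> (\<forall>j. \<forall>k\<le>2^j. B (g j k) \<omega> + \<gamma> * g j k \<le> y)"
      using elim by (simp add: E_def)
    also have "\<dots> \<longleftrightarrow> (\<forall>s\<in>{0..t}. B s \<omega> + \<gamma> * s \<le> y)"
    proof safe
      fix s assume le: "\<forall>j. \<forall>k\<le>2^j. B (g j k) \<omega> + \<gamma> * g j k \<le> y" and s: "s \<in> {0..t}"
      obtain k where k: "\<And>j. k j \<le> 2 ^ j" and lim: "(\<lambda>j. g j (k j)) \<longlonglongrightarrow> s"
        using dyadic_dense[OF t, of s] s unfolding g_def by auto
      have "(\<lambda>j. B (g j (k j)) \<omega>) \<longlonglongrightarrow> B s \<omega>"
        by (rule continuous_on_tendsto_compose[OF elim(2) lim]) (use s g0 in auto)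
      then have "(\<lambda>j. B (g j (k j)) \<omega> + \<gamma> * g j (k j)) \<longlonglongrightarrow> B s \<omega> + \<gamma> * s"
        by (intro tendsto_intros lim)
      then show "B s \<omega> + \<gamma> * s \<le> y"
        by (rule LIMSEQ_le_const2) (use le k in blast)
    next
      fix j k assume le: "\<forall>s\<in>{0..t}. B s \<omega> + \<gamma> * s \<le> y" and k: "k \<le> (2::nat) ^ j"
      have "real k \<le> real (2 ^ j)" using k by (simp only: of_nat_le_iff)
      then have "g j k \<le> t" using t by (simp add: g_def field_simps)
      then show "B (g j k) \<omega> + \<gamma> * g j k \<le> y"
        using le g0[of j k] by auto
    qed
    finally show ?case .
  qed
qed

end

section \<open>The first-exit time as a running maximum\<close>

text \<open>Without drift the two terms approach the same limit \<open>Phi 0\<close>; with positive drift each of them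
  vanishes.\<close>

lemma barrier_prob_vanishes:
  assumes "0 \<le> \<gamma>"
  shows "(\<lambda>n. barrier_prob \<gamma> (real (Suc n)) y) \<longlonglongrightarrow> 0"
proof -
  have cont: "isCont Phi x" for x by (rule DERIV_isCont[OF Phi_has_real_derivative])
  have "(\<lambda>n. Phi ((y - \<gamma> * real (Suc n)) / sqrt (real (Suc n))) -
      exp (2 * \<gamma> * y) * Phi (- (y + \<gamma> * real (Suc n)) / sqrt (real (Suc n)))) \<longlonglongrightarrow> 0"
  proof (cases "\<gamma> = 0")
    case True
    have "(\<lambda>n. y / sqrt (real (Suc n))) \<longlonglongrightarrow> 0" "(\<lambda>n. - y / sqrt (real (Suc n))) \<longlonglongrightarrow> 0"
      by real_asymp+
    then have "(\<lambda>n. Phi (y / sqrt (real (Suc n))) - Phi (- y / sqrt (real (Suc n)))) \<longlonglongrightarrow> Phi 0 - Phi 0"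
      by (intro tendsto_diff isCont_tendsto_compose[OF cont])
    then show ?thesis by (simp add: True)
  next
    case False
    then have "0 < \<gamma>" using assms by simp
    then have "filterlim (\<lambda>n. (y - \<gamma> * real (Suc n)) / sqrt (real (Suc n))) at_bot sequentially"
      "filterlim (\<lambda>n. - (y + \<gamma> * real (Suc n)) / sqrt (real (Suc n))) at_bot sequentially"
      by real_asymp+
    then have "(\<lambda>n. Phi ((y - \<gamma> * real (Suc n)) / sqrt (real (Suc n))) -
      exp (2 * \<gamma> * y) * Phi (- (y + \<gamma> * real (Suc n)) / sqrt (real (Suc n)))) \<longlonglongrightarrow> 0 - exp (2 * \<gamma> * y) * 0"
      by (intro tendsto_intros filterlim_compose[OF Phi_at_bot])
    then show ?thesis by simp
  qed
  then show ?thesis by (simp add: barrier_prob_eq)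
qed

text \<open>A purely deterministic statement about one path: the set \<open>{u. 0 < u \<and> G u > t}\<close> lies between an
  open and a closed half-line that both start at the maximum over \<open>[0, t]\<close> divided by \<open>\<delta>\<close>. The path has
  to exceed every level, since otherwise the value of \<open>G\<close> at some level would be the infimum of
  the empty set.\<close>

lemma first_exit_time_le_iff:
  fixes B :: "real \<Rightarrow> 'a \<Rightarrow> real"
  assumes cont: "continuous_on {0..} (\<lambda>s. B s \<omega>)" and start: "B 0 \<omega> = 0"
    and unbounded: "\<And>n::nat. \<exists>s>0. \<delta> * real n < B s \<omega> + \<gamma> * s"
    and \<delta>: "0 < \<delta>" and t: "0 < t"
  shows "first_exit_time (ig_subordinator B \<delta> \<gamma>) t \<omega> \<le> x \<longleftrightarrow>
    (\<forall>s\<in>{0..t}. B s \<omega> + \<gamma> * s \<le> \<delta> * x)"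
proof -
  define X where "X s = B s \<omega> + \<gamma> * s" for s
  have contX: "continuous_on {0..} X"
    unfolding X_def by (intro continuous_intros cont)
  define A where "A u = {s. 0 < s \<and> \<delta> * u < X s}" for u
  define G where "G u = Inf (A u)" for u
  have G: "ig_subordinator B \<delta> \<gamma> u \<omega> = G u" for u
    by (simp add: G_def A_def X_def ig_subordinator_def)
  have bdd: "bdd_below (A u)" for u
    by (rule bdd_belowI[of _ 0]) (auto simp: A_def)
  have ne: "A u \<noteq> {}" for u
  proof -
    obtain n :: nat where n: "u \<le> real n" using real_arch_simple by blast
    obtain s where "s > 0" "\<delta> * real n < X s" using unbounded[of n] by (auto simp: X_def)
    moreover have "\<delta> * u \<le> \<delta> * real n" using n \<delta> by simp
    ultimately have "s \<in> A u" unfolding A_def by auto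
    then show ?thesis by blast
  qed
  \<comment> \<open>\<open>X m\<close> is the maximum over \<open>[0, t]\<close>; it is nonnegative because the path starts at 0.\<close>
  obtain m where m: "m \<in> {0..t}" and max: "\<And>s. s \<in> {0..t} \<Longrightarrow> X s \<le> X m"
    using continuous_attains_sup[of "{0..t}" X] continuous_on_subset[OF contX, of "{0..t}"] t by auto
  have nonneg: "0 \<le> X m"
    using max[of 0] t start by (simp add: X_def)
  \<comment> \<open>By continuity the path stays below the level for a little longer than \<open>t\<close>, which makes the
    inequality strict.\<close>
  have above: "t < G u" if u: "X m / \<delta> < u" for u
  proof -
    have Xt: "X t < \<delta> * u"
      using max[of t] t u \<delta> by (simp add: field_simps)
    have "(X \<longlongrightarrow> X t) (at t within {0..})"
      using contX t by (simp add: continuous_on_def)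
    then have "\<forall>\<^sub>F s in at t within {0..}. X s < \<delta> * u"
      using Xt by (rule order_tendstoD)
    then obtain \<eta> where \<eta>: "\<eta> > 0" "\<And>s. s \<in> {0..} \<Longrightarrow> s \<noteq> t \<Longrightarrow> dist s t < \<eta> \<Longrightarrow> X s < \<delta> * u"
      unfolding eventually_at by blast
    have "t + \<eta> \<le> s" if s: "s \<in> A u" for s
    proof (rule ccontr)
      assume "\<not> t + \<eta> \<le> s"
      then have "X s < \<delta> * u"
        using \<eta>(2)[of s] max[of s] u \<delta> s Xt
        by (cases "s \<le> t") (auto simp: A_def dist_real_def field_simps)
      then show False using s by (simp add: A_def)
    qed
    then have "t + \<eta> \<le> G u"
      unfolding G_def by (intro cInf_greatest ne)
    then show ?thesis using \<eta>(1) by simp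
  qed
  have below: "X m / \<delta> \<le> u" if u: "0 < u" "t < G u" for u
  proof (rule ccontr)
    assume "\<not> X m / \<delta> \<le> u"
    then have Xm: "\<delta> * u < X m" using \<delta> by (simp add: field_simps)
    moreover have "m \<noteq> 0" using Xm mult_pos_pos[OF \<delta> u(1)] start by (auto simp: X_def)
    ultimately have "m \<in> A u" using m by (simp add: A_def)
    then have "G u \<le> m" unfolding G_def by (rule cInf_lower) (rule bdd)
    then show False using m u by simp
  qed
  let ?U = "{u. 0 < u \<and> t < G u}"
  have "Inf ?U = X m / \<delta>"
  proof (rule antisym)
    show "Inf ?U \<le> X m / \<delta>"
    proof (rule field_le_epsilon)
      fix e :: real assume e: "0 < e"
      have "0 \<le> X m / \<delta>" using nonneg \<delta> by simp
      then have "X m / \<delta> + e \<in> ?U" using above[of "X m / \<delta> + e"] e by simp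
      then show "Inf ?U \<le> X m / \<delta> + e"
        by (rule cInf_lower) (auto intro: bdd_belowI[of _ 0])
    qed
    show "X m / \<delta> \<le> Inf ?U"
    proof (rule cInf_greatest)
      have "0 \<le> X m / \<delta>" using nonneg \<delta> by simp
      then have "X m / \<delta> + 1 \<in> ?U" using above[of "X m / \<delta> + 1"] by simp
      then show "?U \<noteq> {}" by blast
    qed (use below in auto)
  qed
  then have "first_exit_time (ig_subordinator B \<delta> \<gamma>) t \<omega> = X m / \<delta>"
    by (simp add: first_exit_time_def G)
  then have "first_exit_time (ig_subordinator B \<delta> \<gamma>) t \<omega> \<le> x \<longleftrightarrow> X m \<le> \<delta> * x"
    using pos_divide_le_eq[OF \<delta>, of "X m" x] by (simp add: mult.commute)
  also have "\<dots> \<longleftrightarrow> (\<forall>s\<in>{0..t}. X s \<le> \<delta> * x)"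
    using m max order_trans by blast
  finally show ?thesis by (simp add: X_def)
qed

context standard_brownian_motion
begin

text \<open>Otherwise the path would stay below \<open>y\<close> on every interval \<open>[0, n]\<close>, and the probability of
  that tends to 0.\<close>

lemma AE_exceeds_level:
  assumes \<gamma>: "0 \<le> \<gamma>" and y: "0 \<le> y"
  shows "AE \<omega> in M. \<exists>s>0. y < B s \<omega> + \<gamma> * s"
proof -
  have "\<exists>E. E \<in> events \<and> prob E = barrier_prob \<gamma> (real (Suc n)) y \<and>
      (AE \<omega> in M. \<omega> \<in> E \<longleftrightarrow> (\<forall>s\<in>{0..real (Suc n)}. B s \<omega> + \<gamma> * s \<le> y))" for n
    by (rule prob_path_below[of "real (Suc n)" y \<gamma>]) (use y \<gamma> in auto)
  then have "\<exists>E. \<forall>n. E n \<in> events \<and> prob (E n) = barrier_prob \<gamma> (real (Suc n)) y \<and>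
      (AE \<omega> in M. \<omega> \<in> E n \<longleftrightarrow> (\<forall>s\<in>{0..real (Suc n)}. B s \<omega> + \<gamma> * s \<le> y))"
    by (intro choice allI)
  then obtain E where E: "\<And>n. E n \<in> events" "\<And>n. prob (E n) = barrier_prob \<gamma> (real (Suc n)) y"
    "\<And>n. AE \<omega> in M. \<omega> \<in> E n \<longleftrightarrow> (\<forall>s\<in>{0..real (Suc n)}. B s \<omega> + \<gamma> * s \<le> y)"
    by blast
  have ev: "(\<Inter>n. E n) \<in> events" using E(1) by (intro sets.countable_INT) auto
  have "prob (\<Inter>n. E n) \<le> barrier_prob \<gamma> (real (Suc n)) y" for n
    unfolding E(2)[symmetric] by (rule finite_measure_mono) (use E(1) in auto)
  then have "prob (\<Inter>n. E n) \<le> 0"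
    by (intro LIMSEQ_le_const[OF barrier_prob_vanishes[OF \<gamma>]]) auto
  then have "prob (\<Inter>n. E n) = 0"
    using measure_nonneg[of M "\<Inter>n. E n"] by linarith
  then have "AE \<omega> in M. \<omega> \<notin> (\<Inter>n. E n)"
    using ev by (subst (asm) prob_eq_0) auto
  moreover have "AE \<omega> in M. \<forall>n. \<omega> \<in> E n \<longleftrightarrow> (\<forall>s\<in>{0..real (Suc n)}. B s \<omega> + \<gamma> * s \<le> y)"
    using E(3) by (simp add: AE_all_countable)
  ultimately show ?thesis
    using start_zero
  proof eventually_elim
    case (elim \<omega>)
    then obtain s where "s \<ge> 0" "y < B s \<omega> + \<gamma> * s" by (auto simp: not_le)
    moreover have "s \<noteq> 0" using calculation elim y by auto
    ultimately show ?case by (intro exI[of _ s]) auto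
  qed
qed

lemma prob_first_exit_time_le:
  assumes \<delta>: "0 < \<delta>" and \<gamma>: "0 \<le> \<gamma>" and t: "0 < t" and x: "0 \<le> x"
    and H: "first_exit_time (ig_subordinator B \<delta> \<gamma>) t \<in> borel_measurable M"
  shows "prob {\<omega> \<in> space M. first_exit_time (ig_subordinator B \<delta> \<gamma>) t \<omega> \<le> x} = barrier_prob \<gamma> t (\<delta> * x)"
proof -
  have "0 \<le> \<delta> * x" using \<delta> x by simp
  then obtain E where E: "E \<in> events" "prob E = barrier_prob \<gamma> t (\<delta> * x)"
    "AE \<omega> in M. \<omega> \<in> E \<longleftrightarrow> (\<forall>s\<in>{0..t}. B s \<omega> + \<gamma> * s \<le> \<delta> * x)"
    using prob_path_below[OF t _ \<gamma>] by blast
  have "AE \<omega> in M. \<forall>n::nat. \<exists>s>0. \<delta> * real n < B s \<omega> + \<gamma> * s"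
    using AE_exceeds_level[OF \<gamma>] \<delta> by (simp add: AE_all_countable)
  with E(3) start_zero continuous_paths AE_space
  have "AE \<omega> in M. \<omega> \<in> {\<omega> \<in> space M. first_exit_time (ig_subordinator B \<delta> \<gamma>) t \<omega> \<le> x} \<longleftrightarrow> \<omega> \<in> E"
    by eventually_elim (simp add: first_exit_time_le_iff[OF _ _ _ \<delta> t])
  then show ?thesis
    unfolding E(2)[symmetric] using H E(1) by (intro finite_measure_eq_AE) auto
qed

end

section \<open>The density of the first-exit time\<close>

text \<open>The Gaussian densities contributed by the direct and the image term coincide, hence the
  factor 2.\<close>

lemma barrier_prob_has_real_derivative:
  assumes t: "0 < t"
  shows "(barrier_prob \<gamma> t has_real_derivative
    2 * std_normal_density ((y - \<gamma> * t) / sqrt t) / sqrt t -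
    2 * \<gamma> * exp (2 * \<gamma> * y) * Phi (- (y + \<gamma> * t) / sqrt t)) (at y)"
proof -
  have mirror: "exp (2 * \<gamma> * y) * std_normal_density (- (y + \<gamma> * t) / sqrt t) =
      std_normal_density ((y - \<gamma> * t) / sqrt t)"
  proof -
    have "2 * \<gamma> * y + - ((y + \<gamma> * t)\<^sup>2 / t) / 2 = - ((y - \<gamma> * t)\<^sup>2 / t) / 2"
      using t by (simp add: field_simps power2_eq_square)
    then have "exp (2 * \<gamma> * y) * exp (- ((y + \<gamma> * t)\<^sup>2 / t) / 2) = exp (- ((y - \<gamma> * t)\<^sup>2 / t) / 2)"
      unfolding exp_add[symmetric] by (simp only:)
    moreover have "(- (y + \<gamma> * t) / sqrt t)\<^sup>2 = (y + \<gamma> * t)\<^sup>2 / t" "((y - \<gamma> * t) / sqrt t)\<^sup>2 = (y - \<gamma> * t)\<^sup>2 / t"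
      using t by (simp_all only: power_divide power2_minus real_sqrt_pow2 less_imp_le)
    ultimately show ?thesis
      unfolding std_normal_density_def by (simp only: mult.left_commute[of "exp (2 * \<gamma> * y)"])
  qed
  have d1: "((\<lambda>y. Phi ((y - \<gamma> * t) / sqrt t)) has_real_derivative
      std_normal_density ((y - \<gamma> * t) / sqrt t) * (1 / sqrt t)) (at y)"
    by (rule DERIV_chain2[OF Phi_has_real_derivative]) (use t in \<open>auto intro!: derivative_eq_intros
        simp: sqrt_divide_self_eq inverse_eq_divide\<close>)
  have d2: "((\<lambda>y. Phi (- (y + \<gamma> * t) / sqrt t)) has_real_derivative
      std_normal_density (- (y + \<gamma> * t) / sqrt t) * (- 1 / sqrt t)) (at y)"
    by (rule DERIV_chain2[OF Phi_has_real_derivative]) (use t in \<open>auto intro!: derivative_eq_intros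
        simp: sqrt_divide_self_eq inverse_eq_divide\<close>)
  have d3: "((\<lambda>y. exp (2 * \<gamma> * y)) has_real_derivative 2 * \<gamma> * exp (2 * \<gamma> * y)) (at y)"
    by (auto intro!: derivative_eq_intros)
  have "((\<lambda>y. Phi ((y - \<gamma> * t) / sqrt t) - exp (2 * \<gamma> * y) * Phi (- (y + \<gamma> * t) / sqrt t)) has_real_derivative
      std_normal_density ((y - \<gamma> * t) / sqrt t) * (1 / sqrt t) -
      (2 * \<gamma> * exp (2 * \<gamma> * y) * Phi (- (y + \<gamma> * t) / sqrt t) +
       std_normal_density (- (y + \<gamma> * t) / sqrt t) * (- 1 / sqrt t) * exp (2 * \<gamma> * y))) (at y)"
    by (rule DERIV_diff[OF d1 DERIV_mult[OF d3 d2]])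
  moreover have "std_normal_density ((y - \<gamma> * t) / sqrt t) * (1 / sqrt t) -
      (2 * \<gamma> * exp (2 * \<gamma> * y) * Phi (- (y + \<gamma> * t) / sqrt t) +
       std_normal_density (- (y + \<gamma> * t) / sqrt t) * (- 1 / sqrt t) * exp (2 * \<gamma> * y)) =
    2 * std_normal_density ((y - \<gamma> * t) / sqrt t) / sqrt t -
    2 * \<gamma> * exp (2 * \<gamma> * y) * Phi (- (y + \<gamma> * t) / sqrt t)"
  proof -
    have "std_normal_density (- (y + \<gamma> * t) / sqrt t) * (- 1 / sqrt t) * exp (2 * \<gamma> * y) =
        - (std_normal_density ((y - \<gamma> * t) / sqrt t) / sqrt t)"
      unfolding mirror[symmetric] by simp
    then show ?thesis by (simp only:) simp
  qed
  ultimately show ?thesis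
    by (simp only: barrier_prob_eq[OF t, abs_def])
qed

text \<open>A density is determined only almost everywhere, but a continuous version on an open half-line
  is determined at each of its points, being the derivative of the distribution function.\<close>

lemma (in prob_space) continuous_density_unique:
  fixes X :: "'a \<Rightarrow> real" and f F :: "real \<Rightarrow> real"
  assumes X: "distributed M lborel X (\<lambda>x. ennreal (f x))" and nonneg: "\<And>x. 0 \<le> f x"
    and cont: "continuous_on {a<..} f"
    and cdf: "\<And>x. a < x \<Longrightarrow> prob {\<omega> \<in> space M. X \<omega> \<le> x} = F x"
    and deriv: "(F has_real_derivative D) (at x)" and x: "a < x"
  shows "f x = D"
proof -
  obtain l where l: "a < l" "l < x" using dense[OF x] by blast
  have Xm[measurable]: "X \<in> borel_measurable M"
    using distributed_measurable[OF X] by simp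
  have cont': "continuous_on {l..r} f" for r
    by (rule continuous_on_subset[OF cont]) (use l in auto)
  have F: "F y = F l + integral {l..y} f" if "l < y" for y
  proof -
    have int: "set_integrable lborel {l..y} f"
      by (rule borel_integrable_atLeastAtMost'[OF cont'])
    \<comment> \<open>The half-open interval is the difference of two values of the distribution function; its
      closure has the same Lebesgue integral.\<close>
    have "F y - F l = prob ({\<omega> \<in> space M. X \<omega> \<le> y} - {\<omega> \<in> space M. X \<omega> \<le> l})"
      using that l cdf[of y] cdf[of l] by (subst finite_measure_Diff) auto
    also have "{\<omega> \<in> space M. X \<omega> \<le> y} - {\<omega> \<in> space M. X \<omega> \<le> l} = X -` {l<..y} \<inter> space M"
      by auto
    also have "ennreal (prob (X -` {l<..y} \<inter> space M)) = (\<integral>\<^sup>+z. ennreal (f z) * indicator {l<..y} z \<partial>lborel)"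
      using distributed_emeasure[OF X, of "{l<..y}"] by (simp add: emeasure_eq_measure)
    also have "\<dots> = (\<integral>\<^sup>+z. ennreal (indicator {l..y} z *\<^sub>R f z) \<partial>lborel)"
      by (intro nn_integral_cong_AE) (use AE_lborel_singleton[of l] in \<open>auto split: split_indicator\<close>)
    also have "\<dots> = ennreal (LINT z:{l..y}|lborel. f z)"
      unfolding set_lebesgue_integral_def
      by (rule nn_integral_eq_integral) (use int nonneg in \<open>auto simp: set_integrable_def\<close>)
    also have "(LINT z:{l..y}|lborel. f z) = integral {l..y} f"
      by (rule set_borel_integral_eq_integral[OF int])
    finally have "ennreal (F y - F l) = ennreal (integral {l..y} f)" .
    moreover have "0 \<le> F y - F l"
      using that l cdf[of y, symmetric] cdf[of l, symmetric] by (auto intro!: finite_measure_mono)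
    moreover have "0 \<le> integral {l..y} f"
      by (rule integral_nonneg) (use cont' nonneg in \<open>auto intro: integrable_continuous_real\<close>)
    ultimately show ?thesis by simp
  qed
  have "((\<lambda>y. integral {l..y} f) has_real_derivative f x) (at x within {l..x + 1})"
    by (rule integral_has_real_derivative[OF cont']) (use l in auto)
  then have "((\<lambda>y. integral {l..y} f) has_real_derivative f x) (at x)"
    using l by (subst (asm) at_within_Icc_at) auto
  then have "((\<lambda>y. F l + integral {l..y} f) has_real_derivative f x) (at x)"
    by (auto intro!: derivative_eq_intros)
  then have "(F has_real_derivative f x) (at x)"
    by (rule DERIV_cong_ev[THEN iffD1, rotated -1])
       (use l F[symmetric] in \<open>auto intro!: eventually_mono[OF eventually_nhds_in_open[of "{l<..}"]]\<close>)
  then show ?thesis using deriv by (rule DERIV_unique)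
qed

section \<open>The Laplace transform in the time variable\<close>

text \<open>For \<open>r \<ge> 0\<close> and \<open>a > 0\<close>, the sum of the two terms below is \<open>exp (- r * a)\<close> times the
  probability that a Brownian motion with drift \<open>r\<close> exceeds level \<open>a\<close> before time \<open>t\<close>. In their
  derivatives, \<open>heat_factor t / sqrt t\<close> occurs with opposite signs and
  \<open>heat_factor t / (t * sqrt t)\<close> with equal signs, so that the difference and the sum are
  antiderivatives of multiples of these two functions.\<close>

context
  fixes r a :: real
begin

definition direct_term :: "real \<Rightarrow> real" where "direct_term t = exp (- r * a) * Phi ((r * t - a) / sqrt t)"
definition mirror_term :: "real \<Rightarrow> real" where "mirror_term t = exp (r * a) * Phi (- (a + r * t) / sqrt t)"
definition heat_factor :: "real \<Rightarrow> real" where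
  "heat_factor t = exp (- (a\<^sup>2 / t + r\<^sup>2 * t) / 2) / sqrt (2 * pi)"

lemma std_normal_density_eq_heat_factor:
  assumes "0 < t"
  shows "exp (- r * a) * std_normal_density ((r * t - a) / sqrt t) = heat_factor t"
    and "exp (r * a) * std_normal_density (- (a + r * t) / sqrt t) = heat_factor t"
proof -
  have e: "- r * a + - ((r * t - a)\<^sup>2 / t) / 2 = - (a\<^sup>2 / t + r\<^sup>2 * t) / 2"
    "r * a + - ((a + r * t)\<^sup>2 / t) / 2 = - (a\<^sup>2 / t + r\<^sup>2 * t) / 2"
    using assms by (simp_all add: field_simps power2_eq_square)
  have sq: "((r * t - a) / sqrt t)\<^sup>2 = (r * t - a)\<^sup>2 / t" "(- (a + r * t) / sqrt t)\<^sup>2 = (a + r * t)\<^sup>2 / t"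
    using assms by (simp_all only: power_divide power2_minus real_sqrt_pow2 less_imp_le)
  show "exp (- r * a) * std_normal_density ((r * t - a) / sqrt t) = heat_factor t"
    unfolding std_normal_density_def heat_factor_def sq e(1)[symmetric] exp_add by simp
  show "exp (r * a) * std_normal_density (- (a + r * t) / sqrt t) = heat_factor t"
    unfolding std_normal_density_def heat_factor_def sq e(2)[symmetric] exp_add by simp
qed

lemma direct_term_has_real_derivative:
  assumes t: "0 < t"
  shows "(direct_term has_real_derivative heat_factor t * (r / sqrt t + a / (t * sqrt t)) / 2) (at t)"
proof -
  have st: "sqrt t > 0" "sqrt t * sqrt t = t" using t by auto
  have "((\<lambda>t. (r * t - a) / sqrt t) has_real_derivative (r / sqrt t + a / (t * sqrt t)) / 2) (at t)"
    using t st by (auto intro!: derivative_eq_intros simp: field_simps)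
  from DERIV_cmult[OF DERIV_chain2[OF Phi_has_real_derivative this], of "exp (- r * a)"]
  have "(direct_term has_real_derivative exp (- r * a) * (std_normal_density ((r * t - a) / sqrt t) *
      ((r / sqrt t + a / (t * sqrt t)) / 2))) (at t)"
    by (simp only: direct_term_def[abs_def])
  then show ?thesis
    unfolding std_normal_density_eq_heat_factor(1)[OF t, symmetric] by (simp only: mult.assoc times_divide_eq_right)
qed

lemma mirror_term_has_real_derivative:
  assumes t: "0 < t"
  shows "(mirror_term has_real_derivative heat_factor t * (a / (t * sqrt t) - r / sqrt t) / 2) (at t)"
proof -
  have st: "sqrt t > 0" "sqrt t * sqrt t = t" using t by auto
  have "((\<lambda>t. - (a + r * t) / sqrt t) has_real_derivative (a / (t * sqrt t) - r / sqrt t) / 2) (at t)"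
    using t st by (auto intro!: derivative_eq_intros simp: field_simps)
  from DERIV_cmult[OF DERIV_chain2[OF Phi_has_real_derivative this], of "exp (r * a)"]
  have "(mirror_term has_real_derivative exp (r * a) * (std_normal_density (- (a + r * t) / sqrt t) *
      ((a / (t * sqrt t) - r / sqrt t) / 2))) (at t)"
    by (simp only: mirror_term_def[abs_def])
  then show ?thesis
    unfolding std_normal_density_eq_heat_factor(2)[OF t, symmetric] by (simp only: mult.assoc times_divide_eq_right)
qed

lemma direct_term_at_0:
  assumes "0 < a"
  shows "(direct_term \<longlongrightarrow> 0) (at_right 0)"
proof -
  have "filterlim (\<lambda>t. (r * t - a) / sqrt t) at_bot (at_right 0)"
    using assms by real_asymp
  from tendsto_mult[OF tendsto_const filterlim_compose[OF Phi_at_bot this]]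
  show ?thesis by (simp add: direct_term_def[abs_def])
qed

lemma mirror_term_at_0:
  assumes "0 < a"
  shows "(mirror_term \<longlongrightarrow> 0) (at_right 0)"
proof -
  have "filterlim (\<lambda>t. - (a + r * t) / sqrt t) at_bot (at_right 0)"
    using assms by real_asymp
  from tendsto_mult[OF tendsto_const filterlim_compose[OF Phi_at_bot this]]
  show ?thesis by (simp add: mirror_term_def[abs_def])
qed

lemma direct_term_at_top:
  assumes "0 < r"
  shows "(direct_term \<longlongrightarrow> exp (- r * a)) at_top"
proof -
  have "filterlim (\<lambda>t. (r * t - a) / sqrt t) at_top at_top"
    using assms by real_asymp
  from tendsto_mult[OF tendsto_const filterlim_compose[OF Phi_at_top this]]
  show ?thesis by (simp add: direct_term_def[abs_def])
qed

lemma mirror_term_at_top: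
  assumes "0 < r"
  shows "(mirror_term \<longlongrightarrow> 0) at_top"
proof -
  have "filterlim (\<lambda>t. - (a + r * t) / sqrt t) at_bot at_top"
    using assms by real_asymp
  from tendsto_mult[OF tendsto_const filterlim_compose[OF Phi_at_bot this]]
  show ?thesis by (simp add: mirror_term_def[abs_def])
qed

lemma mirror_term_bounds: "0 \<le> mirror_term t" "mirror_term t \<le> exp (r * a)"
proof -
  have "Phi z \<le> 1" for z unfolding Phi_def by (rule std_normal.cdf_bounded_prob)
  then show "0 \<le> mirror_term t" "mirror_term t \<le> exp (r * a)"
    unfolding mirror_term_def using Phi_nonneg by (auto intro!: mult_nonneg_nonneg mult_left_le)
qed

end

text \<open>Exponential discounting at rate \<open>s\<close> replaces \<open>\<gamma>\<close> by \<open>sqrt (\<gamma>\<^sup>2 + 2 * s)\<close>; this is where the square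
  root in the Laplace exponent comes from.\<close>

lemma exp_heat_factor:
  assumes "r\<^sup>2 = \<gamma>\<^sup>2 + 2 * s"
  shows "exp (- s * t) * heat_factor \<gamma> a t = heat_factor r a t"
proof -
  have "- s * t + - (a\<^sup>2 / t + \<gamma>\<^sup>2 * t) / 2 = - (a\<^sup>2 / t + r\<^sup>2 * t) / 2"
    unfolding assms by (simp add: field_simps)
  then have "exp (- s * t) * exp (- (a\<^sup>2 / t + \<gamma>\<^sup>2 * t) / 2) = exp (- (a\<^sup>2 / t + r\<^sup>2 * t) / 2)"
    unfolding exp_add[symmetric] by (simp only:)
  then show ?thesis unfolding heat_factor_def by (simp only: times_divide_eq_right)
qed

text \<open>The function \<open>f\<close> is the density at \<open>a\<close> of the running maximum at time \<open>t\<close>. Its discounted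
  first term is an elementary multiple of \<open>heat_factor r a t / sqrt t\<close>. The second term is integrated by
  parts, which moves the derivative from \<open>exp (- s * t)\<close> to the image term and leaves again multiples of
  \<open>heat_factor r a\<close>.\<close>

lemma laplace_running_max_density:
  fixes \<gamma> s a :: real and f :: "real \<Rightarrow> real"
  assumes \<gamma>: "0 \<le> \<gamma>" and s: "0 < s" and a: "0 < a"
    and f: "\<And>t. 0 < t \<Longrightarrow> f t = 2 * std_normal_density ((a - \<gamma> * t) / sqrt t) / sqrt t -
        2 * \<gamma> * exp (2 * \<gamma> * a) * Phi (- (a + \<gamma> * t) / sqrt t)"
    and nonneg: "\<And>t. 0 < t \<Longrightarrow> 0 \<le> f t"
  shows "(LBINT t:{0<..}. exp (- s * t) * f t) =
    (sqrt (\<gamma>\<^sup>2 + 2 * s) - \<gamma>) / s * exp (- a * (sqrt (\<gamma>\<^sup>2 + 2 * s) - \<gamma>))"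
proof -
  define r where "r = sqrt (\<gamma>\<^sup>2 + 2 * s)"
  have r2: "r\<^sup>2 = \<gamma>\<^sup>2 + 2 * s" using s by (simp add: r_def)
  have r: "0 < r" using s by (simp add: r_def add_nonneg_pos)
  let ?P = "direct_term r a" and ?Q = "mirror_term r a" and ?q = "mirror_term \<gamma> a" and ?K = "heat_factor r a"
  \<comment> \<open>The first summand integrates the Gaussian part of the density; the other two come from
    the integration by parts.\<close>
  define F where "F t = exp (\<gamma> * a) * (2 / r * (?P t - ?Q t) + 2 * \<gamma> / s * (exp (- s * t) * ?q t) -
    \<gamma> / s * (?P t + ?Q t - \<gamma> / r * (?P t - ?Q t)))" for t
  have f_eq: "exp (- s * t) * f t =
      exp (\<gamma> * a) * (2 * ?K t / sqrt t - 2 * \<gamma> * (exp (- s * t) * ?q t))" if t: "0 < t" for t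
  proof -
    have "std_normal_density ((a - \<gamma> * t) / sqrt t) = std_normal_density ((\<gamma> * t - a) / sqrt t)"
      by (simp add: std_normal_density_def power_divide power2_commute)
    also have "\<dots> = exp (\<gamma> * a) * heat_factor \<gamma> a t"
      unfolding std_normal_density_eq_heat_factor(1)[OF t, symmetric]
      by (simp add: mult.assoc[symmetric] exp_add[symmetric])
    finally have "exp (- s * t) * std_normal_density ((a - \<gamma> * t) / sqrt t) = exp (\<gamma> * a) * ?K t"
      unfolding exp_heat_factor[OF r2, symmetric] by simp
    moreover have "exp (2 * \<gamma> * a) = exp (\<gamma> * a) * exp (\<gamma> * a)"
      by (simp add: exp_add[symmetric])
    ultimately show ?thesis
      unfolding f[OF t] mirror_term_def by (simp add: right_diff_distrib mult_ac)
  qed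
  have deriv: "(F has_real_derivative exp (- s * t) * f t) (at t)" if t: "0 < t" for t
  proof -
    note P = direct_term_has_real_derivative[OF t, of r a] and Q = mirror_term_has_real_derivative[OF t, of r a]
      and q = mirror_term_has_real_derivative[OF t, of \<gamma> a]
    have E: "((\<lambda>t. exp (- s * t)) has_real_derivative - s * exp (- s * t)) (at t)"
      by (auto intro!: derivative_eq_intros)
    note PQ = DERIV_diff[OF P Q]
    have K: "heat_factor \<gamma> a t * exp (- s * t) = ?K t"
      using exp_heat_factor[OF r2, of t a] by (simp only: mult.commute)
    define u v where "u = ?K t / sqrt t" and "v = ?K t * (a / (t * sqrt t))"
    have d1: "((\<lambda>t. ?P t - ?Q t) has_real_derivative r * u) (at t)"
      by (rule DERIV_cong[OF PQ]) (simp add: u_def field_simps)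
    have d2: "((\<lambda>t. ?P t + ?Q t) has_real_derivative v) (at t)"
      by (rule DERIV_cong[OF DERIV_add[OF P Q]]) (simp add: v_def field_simps)
    have d3: "((\<lambda>t. exp (- s * t) * ?q t) has_real_derivative
        - s * (exp (- s * t) * ?q t) + (v - \<gamma> * u) / 2) (at t)"
      by (rule DERIV_cong[OF DERIV_mult[OF E q]])
        (simp add: u_def v_def K[symmetric] field_simps)
    have "(F has_real_derivative exp (\<gamma> * a) * (2 / r * (r * u) +
        2 * \<gamma> / s * (- s * (exp (- s * t) * ?q t) + (v - \<gamma> * u) / 2) -
        \<gamma> / s * (v - \<gamma> / r * (r * u)))) (at t)"
      unfolding F_def
      by (intro DERIV_cmult DERIV_diff DERIV_add d1 d2 d3)
    moreover have "2 / r * (r * u) + 2 * \<gamma> / s * (- s * (exp (- s * t) * ?q t) + (v - \<gamma> * u) / 2) -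
        \<gamma> / s * (v - \<gamma> / r * (r * u)) = 2 * u - 2 * \<gamma> * (exp (- s * t) * ?q t)"
    proof -
      define w where "w = exp (- s * t) * ?q t"
      show ?thesis
        unfolding w_def[symmetric] using r s by (simp add: field_simps)
    qed
    ultimately show ?thesis
      unfolding f_eq[OF t] by (simp add: u_def)
  qed
  have cont: "isCont (\<lambda>t. exp (- s * t) * f t) t" if t: "0 < t" for t
  proof -
    have "isCont (\<lambda>t. exp (\<gamma> * a) * (2 * ?K t / sqrt t - 2 * \<gamma> * (exp (- s * t) * ?q t))) t"
      unfolding heat_factor_def using t DERIV_isCont[OF mirror_term_has_real_derivative[OF t, of \<gamma> a]]
      by (intro continuous_intros) auto
    moreover have "\<forall>\<^sub>F u in nhds t. exp (- s * u) * f u =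
        exp (\<gamma> * a) * (2 * ?K u / sqrt u - 2 * \<gamma> * (exp (- s * u) * ?q u))"
      by (rule eventually_mono[OF eventually_nhds_in_open[of "{0<..}"]]) (use t f_eq in auto)
    ultimately show ?thesis by (simp only: isCont_cong)
  qed
  have exp_q: "((\<lambda>t. exp (- s * t) * ?q t) \<longlongrightarrow> 0) at_top"
  proof (rule tendsto_sandwich[OF _ _ tendsto_const])
    show "((\<lambda>t. exp (- s * t) * exp (\<gamma> * a)) \<longlongrightarrow> 0) at_top"
      using s by real_asymp
  qed (use mirror_term_bounds[of \<gamma> a] in \<open>auto intro!: always_eventually mult_left_mono\<close>)
  have lim0: "(F \<longlongrightarrow> 0) (at_right 0)"
  proof -
    have "((\<lambda>t. exp (- s * t)) \<longlongrightarrow> 1) (at_right 0)" by real_asymp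
    then have "(F \<longlongrightarrow> exp (\<gamma> * a) * (2 / r * (0 - 0) + 2 * \<gamma> / s * (1 * 0) -
        \<gamma> / s * (0 + 0 - \<gamma> / r * (0 - 0)))) (at_right 0)"
      unfolding F_def by (intro tendsto_intros direct_term_at_0 mirror_term_at_0 a)
    then show ?thesis by simp
  qed
  have lim1: "(F \<longlongrightarrow> (r - \<gamma>) / s * exp (- a * (r - \<gamma>))) at_top"
  proof -
    have "(F \<longlongrightarrow> exp (\<gamma> * a) * (2 / r * (exp (- r * a) - 0) + 2 * \<gamma> / s * 0 -
        \<gamma> / s * (exp (- r * a) + 0 - \<gamma> / r * (exp (- r * a) - 0)))) at_top"
      unfolding F_def by (intro tendsto_intros direct_term_at_top mirror_term_at_top exp_q r)
    also have "exp (\<gamma> * a) * (2 / r * (exp (- r * a) - 0) + 2 * \<gamma> / s * 0 -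
        \<gamma> / s * (exp (- r * a) + 0 - \<gamma> / r * (exp (- r * a) - 0))) =
        (2 / r - \<gamma> / s * (1 - \<gamma> / r)) * (exp (\<gamma> * a) * exp (- r * a))"
      by (simp add: algebra_simps)
    also have "2 / r - \<gamma> / s * (1 - \<gamma> / r) = (r - \<gamma>) / s"
    proof -
      have "2 * s = r * r - \<gamma> * \<gamma>" using r2 by (simp add: power2_eq_square)
      then show ?thesis using r s by (simp add: field_simps)
    qed
    also have "exp (\<gamma> * a) * exp (- r * a) = exp (- a * (r - \<gamma>))"
      by (simp add: exp_add[symmetric] algebra_simps)
    finally show ?thesis .
  qed
  have "(LBINT t=0..\<infinity>. exp (- s * t) * f t) = (r - \<gamma>) / s * exp (- a * (r - \<gamma>)) - 0"
  proof (rule interval_integral_FTC_nonneg(2))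
    show "((F \<circ> real_of_ereal) \<longlongrightarrow> 0) (at_right 0)"
      using lim0 by (simp add: zero_ereal_def ereal_tendsto_simps)
    show "((F \<circ> real_of_ereal) \<longlongrightarrow> (r - \<gamma>) / s * exp (- a * (r - \<gamma>))) (at_left \<infinity>)"
      using lim1 by (simp add: ereal_tendsto_simps)
  qed (use deriv cont nonneg in \<open>auto simp: zero_ereal_def\<close>)
  then show ?thesis
    by (simp add: interval_lebesgue_integral_def einterval_eq_Ici zero_ereal_def r_def)
qed

theorem corollary2p1:
  fixes M :: "'a measure" and B G H :: "real \<Rightarrow> 'a \<Rightarrow> real"
    and \<delta> \<gamma> x s :: real and h :: "real \<Rightarrow> real \<Rightarrow> real"
  assumes "standard_brownian_motion M B"
    and "\<delta> > 0" and "\<gamma> \<ge> 0"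
    and "G = ig_subordinator B \<delta> \<gamma>"
    and "H = first_exit_time G"
    and "density_family M H h"
    and "x > 0" and "s > 0"
  shows "(LBINT t:{0<..}. exp (- s * t) * h x t) =
    \<delta> / s * (sqrt (\<gamma>\<^sup>2 + 2 * s) - \<gamma>) * exp (- \<delta> * x * (sqrt (\<gamma>\<^sup>2 + 2 * s) - \<gamma>))"
proof -
  interpret standard_brownian_motion M B by fact
  \<comment> \<open>The density of the maximum itself, at the point \<open>\<delta> * x\<close>.\<close>
  define f where "f t = h x t / \<delta>" for t
  have h: "distributed M lborel (H t) (\<lambda>x. ennreal (h x t))" "\<And>x. 0 \<le> h x t"
    "continuous_on {0<..} (\<lambda>x. h x t)" if "0 < t" for t
    using assms(6) that by (auto simp: density_family_def)
  have f: "f t = 2 * std_normal_density ((\<delta> * x - \<gamma> * t) / sqrt t) / sqrt t -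
      2 * \<gamma> * exp (2 * \<gamma> * (\<delta> * x)) * Phi (- (\<delta> * x + \<gamma> * t) / sqrt t)" (is "_ = ?u t")
    if t: "0 < t" for t
  proof -
    have Hm: "H t \<in> borel_measurable M"
      using distributed_measurable[OF h(1)[OF t]] by simp
    have "((\<lambda>x. barrier_prob \<gamma> t (\<delta> * x)) has_real_derivative ?u t * \<delta>) (at x)"
      by (rule DERIV_chain2[OF barrier_prob_has_real_derivative[OF t]])
        (auto intro!: derivative_eq_intros)
    then have "h x t = ?u t * \<delta>"
    proof (rule continuous_density_unique[OF h(1)[OF t] h(2)[OF t] h(3)[OF t], rotated])
      show "prob {\<omega> \<in> space M. H t \<omega> \<le> y} = barrier_prob \<gamma> t (\<delta> * y)" if "0 < y" for y
        using prob_first_exit_time_le[OF assms(2,3) t, of y] that Hm by (simp add: assms(4,5))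
    qed (fact assms(7))
    then show ?thesis using assms(2) by (simp add: f_def)
  qed
  have "(LBINT t:{0<..}. exp (- s * t) * f t) =
      (sqrt (\<gamma>\<^sup>2 + 2 * s) - \<gamma>) / s * exp (- (\<delta> * x) * (sqrt (\<gamma>\<^sup>2 + 2 * s) - \<gamma>))"
    by (rule laplace_running_max_density[OF _ _ _ f])
      (use assms h(2) in \<open>auto simp: f_def\<close>)
  moreover have "exp (- s * t) * h x t = \<delta> * (exp (- s * t) * f t)" for t
    using assms(2) by (simp add: f_def)
  then have "(LBINT t:{0<..}. exp (- s * t) * h x t) = \<delta> * (LBINT t:{0<..}. exp (- s * t) * f t)"
    by (simp only: set_integral_mult_right)
  ultimately show ?thesis by simp
qed

end
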